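(* Let $\mathcal{H}$ be a separable (real) Hilbert space, $T>0$, $m\in\mathbb{N}$, and let the control pair $(\bar u,\bar b)\in W^{1,1}([0,T],\mathcal{H}^m)\times W^{1,1}([0,T],\mathbb{R}^m)$ satisfy the uniform Slater condition: for every $t\in[0,T]$ there exists $x\in\mathcal{H}$ with $\langle\bar u_i(t),x\rangle<\bar b_i(t)$ for all $i=1,\dots,m$. Then there exist a number $\rho>0$ and a continuous function $K:\mathcal{H}\times\mathcal{H}\to\mathbb{R}_+$ such that for all control pairs $$(u,b),(u',b')\in\big[W^{1,1}([0,T],\mathcal{H}^m)\times W^{1,1}([0,T],\mathbb{R}^m)\big]\cap\mathbb{B}_{1,1}\big((\bar u,\bar b),\rho\big),$$ for all initial values $x_0\in C_{(u,b)}(0)$, $x_0'\in C_{(u',b')}(0)$, and for the associated solutions $x$, $x'$ of the sweeping processes $(\mathcal{S}_{(u,b,x_0)})$ and $(\mathcal{S}_{(u',b',x_0')})$, respectively, one has $$\|x(t)-x'(t)\|^2\le\|x_0-x_0'\|^2+K(x_0,x_0')\,\|(u-u',b-b')\|_\infty\qquad\forall t\in[0,T].$$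
   Context: For a control pair $(u,b):[0,T]\to\mathcal{H}^m\times\mathbb{R}^m$, $C_{(u,b)}(t):=\{x\in\mathcal{H}\mid\langle u_i(t),x\rangle\le b_i(t),\ i=1,\dots,m\}$. For $x_0\in C_{(u,b)}(0)$, $(\mathcal{S}_{(u,b,x_0)})$ denotes the sweeping process $-\dot x(t)\in N_{C_{(u,b)}(t)}(x(t))$ for a.e. $t\in[0,T]$, $x(0)=x_0$; solutions are absolutely continuous functions $x:[0,T]\to\mathcal{H}$ (which satisfy $x(t)\in C_{(u,b)}(t)$ for all $t$). For convex $C\subseteq\mathcal{H}$, $N_C(x):=\{v\mid\langle v,y-x\rangle\le0\ \forall y\in C\}$ if $x\in C$ and $N_C(x):=\emptyset$ otherwise. Norms: $\|(u,b)\|_\infty:=\max_{t\in[0,T],\,i}\|u_i(t)\|+\max_{t\in[0,T],\,i}|b_i(t)|$, and $\|(u,b)\|_{1,1}:=\sum_{i=1}^m\big(\|u_i(0)\|+\int_0^T\|\dot u_i(t)\|dt\big)+\sum_{i=1}^m\big(|b_i(0)|+\int_0^T|\dot b_i(t)|dt\big)$; $\mathbb{B}_{1,1}((\bar u,\bar b),\rho)$ is the closed ball of radius $\rho$ around $(\bar u,\bar b)$ in the norm $\|\cdot\|_{1,1}$. *)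

theory Defs
  imports "HOL-Analysis.Analysis"
begin

text \<open>
  \<open>W\<^sup>1\<^sup>,\<^sup>1([0,T], E)\<close> for a separable Banach space \<open>E\<close>, every class being identified
  with its continuous representative, i.e. with the primitive of a Bochner integrable function.
  Values outside \<open>[0,T]\<close> are irrelevant throughout.
\<close>

definition has_weak_deriv ::
    "real \<Rightarrow> (real \<Rightarrow> 'a::{banach, second_countable_topology}) \<Rightarrow> (real \<Rightarrow> 'a) \<Rightarrow> bool" where
  "has_weak_deriv T f g \<longleftrightarrow>
     integrable (lebesgue_on {0..T}) g \<and>
     (\<forall>t\<in>{0..T}. f t = f 0 + integral\<^sup>L (lebesgue_on {0..t}) g)"

definition W11 :: "real \<Rightarrow> (real \<Rightarrow> 'a::{banach, second_countable_topology}) set" where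
  "W11 T = {f. \<exists>g. has_weak_deriv T f g}"

text \<open>The derivative of \<open>f \<in> W11 T\<close> is unique almost everywhere on \<open>[0,T]\<close> only, and is to be
  used only under integrals.\<close>

definition weak_deriv ::
    "real \<Rightarrow> (real \<Rightarrow> 'a::{banach, second_countable_topology}) \<Rightarrow> real \<Rightarrow> 'a" where
  "weak_deriv T f = (SOME g. has_weak_deriv T f g)"

definition control_pairs ::
    "real \<Rightarrow> ((real \<Rightarrow> 'a::{real_inner, banach, second_countable_topology} ^ 'm)
               \<times> (real \<Rightarrow> real ^ 'm)) set" where
  "control_pairs T =
     {(u, b). \<forall>i. (\<lambda>t. u t $ i) \<in> W11 T \<and> (\<lambda>t. b t $ i) \<in> W11 T}"

definition norm_inf ::
    "real \<Rightarrow> (real \<Rightarrow> 'a::real_inner ^ 'm) \<times> (real \<Rightarrow> real ^ 'm::finite) \<Rightarrow> real" where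
  "norm_inf T = (\<lambda>(u, b).
     (SUP (t, i)\<in>{0..T} \<times> UNIV. norm (u t $ i)) + (SUP (t, i)\<in>{0..T} \<times> UNIV. \<bar>b t $ i\<bar>))"

definition norm_11 ::
    "real \<Rightarrow> (real \<Rightarrow> 'a::{real_inner, banach, second_countable_topology} ^ 'm)
               \<times> (real \<Rightarrow> real ^ 'm::finite) \<Rightarrow> real" where
  "norm_11 T = (\<lambda>(u, b).
     (\<Sum>i\<in>UNIV. norm (u 0 $ i)
        + integral\<^sup>L (lebesgue_on {0..T}) (\<lambda>t. norm (weak_deriv T (\<lambda>s. u s $ i) t))) +
     (\<Sum>i\<in>UNIV. \<bar>b 0 $ i\<bar>
        + integral\<^sup>L (lebesgue_on {0..T}) (\<lambda>t. \<bar>weak_deriv T (\<lambda>s. b s $ i) t\<bar>)))"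

definition pair_diff ::
    "(real \<Rightarrow> 'a::real_vector ^ 'm) \<times> (real \<Rightarrow> real ^ 'm)
       \<Rightarrow> (real \<Rightarrow> 'a ^ 'm) \<times> (real \<Rightarrow> real ^ 'm)
       \<Rightarrow> (real \<Rightarrow> 'a ^ 'm) \<times> (real \<Rightarrow> real ^ 'm)" where
  "pair_diff = (\<lambda>(u, b) (u', b'). (\<lambda>t. u t - u' t, \<lambda>t. b t - b' t))"

definition ball_11 ::
    "real \<Rightarrow> (real \<Rightarrow> 'a::{real_inner, banach, second_countable_topology} ^ 'm)
               \<times> (real \<Rightarrow> real ^ 'm::finite) \<Rightarrow> real
       \<Rightarrow> ((real \<Rightarrow> 'a ^ 'm) \<times> (real \<Rightarrow> real ^ 'm)) set" where
  "ball_11 T c \<rho> = {p \<in> control_pairs T. norm_11 T (pair_diff p c) \<le> \<rho>}"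

definition uniform_slater ::
    "real \<Rightarrow> (real \<Rightarrow> 'a::real_inner ^ 'm) \<times> (real \<Rightarrow> real ^ 'm) \<Rightarrow> bool" where
  "uniform_slater T = (\<lambda>(u, b).
     \<forall>t\<in>{0..T}. \<exists>x. \<forall>i. inner (u t $ i) x < b t $ i)"

definition moving_polyhedron ::
    "(real \<Rightarrow> 'a::real_inner ^ 'm) \<times> (real \<Rightarrow> real ^ 'm) \<Rightarrow> real \<Rightarrow> 'a set" where
  "moving_polyhedron = (\<lambda>(u, b) t. {x. \<forall>i. inner (u t $ i) x \<le> b t $ i})"

definition normal_cone :: "'a::real_inner set \<Rightarrow> 'a \<Rightarrow> 'a set" where
  "normal_cone C x = (if x \<in> C then {v. \<forall>y\<in>C. inner v (y - x) \<le> 0} else {})"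

definition absolutely_continuous_on :: "real set \<Rightarrow> (real \<Rightarrow> 'a::real_normed_vector) \<Rightarrow> bool" where
  "absolutely_continuous_on S f \<longleftrightarrow>
     (\<forall>\<epsilon>>0. \<exists>\<delta>>0. \<forall>P::(real \<times> real) set.
        finite P \<and> (\<forall>(a, b)\<in>P. a \<le> b \<and> {a..b} \<subseteq> S) \<and>
        pairwise (\<lambda>(a, b) (c, d). disjnt {a<..<b} {c<..<d}) P \<and>
        (\<Sum>(a, b)\<in>P. b - a) < \<delta>
        \<longrightarrow> (\<Sum>(a, b)\<in>P. norm (f b - f a)) < \<epsilon>)"

text \<open>Viability \<open>x t \<in> C t\<close> is imposed for almost every \<open>t\<close> only, through the normal cone being
  empty off the set; for continuous data and \<open>x0 \<in> C 0\<close> it then holds for every \<open>t \<in> [0,T]\<close>.\<close>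

definition sweeping_solution ::
    "real \<Rightarrow> (real \<Rightarrow> 'a::real_inner ^ 'm) \<times> (real \<Rightarrow> real ^ 'm) \<Rightarrow> 'a \<Rightarrow> (real \<Rightarrow> 'a) \<Rightarrow> bool" where
  "sweeping_solution T p x0 x \<longleftrightarrow>
     absolutely_continuous_on {0..T} x \<and> x 0 = x0 \<and>
     (AE t in lebesgue_on {0..T}. \<exists>v. (x has_vector_derivative v) (at t within {0..T}) \<and>
        - v \<in> normal_cone (moving_polyhedron p t) (x t))"

end

theory Submission
  imports Defs
begin

text \<open>
  On a short time interval all polyhedra of nearby controls contain a common ball, of center \<open>z\<close>
  and radius \<open>r\<close>. Testing \<open>- x' \<in> N (x)\<close> against this ball gives \<open>r * norm x' \<le> - \<langle>x', x - z\<rangle>\<close>,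
  so \<open>norm (x t - z)\<close> decreases and its square controls the total variation of \<open>x\<close>. For two
  solutions \<open>x\<close> and \<open>y\<close>, each point is at distance \<open>O(e)\<close> from the other polyhedron, where
  \<open>e\<close> is the uniform distance of the controls. Hence the derivative of the squared distance of \<open>x\<close> and \<open>y\<close>
  is at most \<open>O(e) * (norm x' + norm y')\<close>, and adding \<open>O(e / r)\<close> times the squared distances to
  \<open>z\<close> yields a decreasing function. The local estimates are chained over \<open>[0,T]\<close> by interval induction.
\<close>

section \<open>Absolutely continuous functions\<close>

lemma absolutely_continuous_onE:
  assumes "absolutely_continuous_on S f" "\<epsilon> > 0"
  obtains \<delta> where "\<delta> > 0" "\<And>P::(real \<times> real) set.
    \<lbrakk>finite P; \<forall>(a, b)\<in>P. a \<le> b \<and> {a..b} \<subseteq> S;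
     pairwise (\<lambda>(a, b) (c, d). disjnt {a<..<b} {c<..<d}) P; (\<Sum>(a, b)\<in>P. b - a) < \<delta>\<rbrakk>
    \<Longrightarrow> (\<Sum>(a, b)\<in>P. norm (f b - f a)) < \<epsilon>"
proof -
  obtain \<delta> where "\<delta> > 0" and \<delta>: "\<forall>P::(real \<times> real) set.
        finite P \<and> (\<forall>(a, b)\<in>P. a \<le> b \<and> {a..b} \<subseteq> S) \<and>
        pairwise (\<lambda>(a, b) (c, d). disjnt {a<..<b} {c<..<d}) P \<and>
        (\<Sum>(a, b)\<in>P. b - a) < \<delta>
        \<longrightarrow> (\<Sum>(a, b)\<in>P. norm (f b - f a)) < \<epsilon>"
    using assms(1)[unfolded absolutely_continuous_on_def, rule_format, OF assms(2)] by (elim exE conjE)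
  then show thesis by (intro that[of \<delta>]) simp_all
qed

lemma absolutely_continuous_on_subset:
  assumes "absolutely_continuous_on S f" "R \<subseteq> S"
  shows "absolutely_continuous_on R f"
  unfolding absolutely_continuous_on_def
proof (intro allI impI)
  fix \<epsilon> :: real assume "\<epsilon> > 0"
  obtain \<delta> where \<delta>: "\<delta> > 0" "\<And>P::(real \<times> real) set.
        \<lbrakk>finite P; \<forall>(a, b)\<in>P. a \<le> b \<and> {a..b} \<subseteq> S;
        pairwise (\<lambda>(a, b) (c, d). disjnt {a<..<b} {c<..<d}) P;
        (\<Sum>(a, b)\<in>P. b - a) < \<delta>\<rbrakk>
        \<Longrightarrow> (\<Sum>(a, b)\<in>P. norm (f b - f a)) < \<epsilon>"
    by (rule absolutely_continuous_onE[OF assms(1) \<open>\<epsilon> > 0\<close>]) iprover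
  show "\<exists>\<delta>>0. \<forall>P::(real \<times> real) set.
        finite P \<and> (\<forall>(a, b)\<in>P. a \<le> b \<and> {a..b} \<subseteq> R) \<and>
        pairwise (\<lambda>(a, b) (c, d). disjnt {a<..<b} {c<..<d}) P \<and>
        (\<Sum>(a, b)\<in>P. b - a) < \<delta>
        \<longrightarrow> (\<Sum>(a, b)\<in>P. norm (f b - f a)) < \<epsilon>"
    using \<delta>(1) assms(2) by (intro exI[of _ \<delta>] conjI allI impI \<delta>(2)) blast+
qed

text \<open>Serves as the common source of the closure properties below: a family of intervals short
  enough for both \<open>f\<close> and \<open>g\<close> is short enough for \<open>h\<close>,
  because the increments of \<open>h\<close> are bounded term by term.\<close>

lemma absolutely_continuous_on_dominated:
  fixes f :: "real \<Rightarrow> 'a::real_normed_vector" and g :: "real \<Rightarrow> 'b::real_normed_vector"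
    and h :: "real \<Rightarrow> 'c::real_normed_vector"
  assumes f: "absolutely_continuous_on S f" and g: "absolutely_continuous_on S g"
    and L: "\<And>s t. s \<in> S \<Longrightarrow> t \<in> S \<Longrightarrow> norm (h t - h s) \<le> L * (norm (f t - f s) + norm (g t - g s))"
  shows "absolutely_continuous_on S h"
  unfolding absolutely_continuous_on_def
proof (intro allI impI)
  fix \<epsilon> :: real assume "\<epsilon> > 0"
  \<comment> \<open>The two halves pay for \<open>f\<close> and \<open>g\<close>; the added 1 keeps
    the factor positive whatever the value of \<open>L\<close>.\<close>
  define e where "e = \<epsilon> / (\<bar>L\<bar> + 1) / 2"
  have "e > 0" using \<open>\<epsilon> > 0\<close> by (simp add: e_def)
  obtain \<delta>1 where \<delta>1: "\<delta>1 > 0" "\<And>P::(real \<times> real) set.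
        \<lbrakk>finite P; \<forall>(a, b)\<in>P. a \<le> b \<and> {a..b} \<subseteq> S;
        pairwise (\<lambda>(a, b) (c, d). disjnt {a<..<b} {c<..<d}) P;
        (\<Sum>(a, b)\<in>P. b - a) < \<delta>1\<rbrakk>
        \<Longrightarrow> (\<Sum>(a, b)\<in>P. norm (f b - f a)) < e"
    by (rule absolutely_continuous_onE[OF f \<open>e > 0\<close>]) iprover
  obtain \<delta>2 where \<delta>2: "\<delta>2 > 0" "\<And>P::(real \<times> real) set.
        \<lbrakk>finite P; \<forall>(a, b)\<in>P. a \<le> b \<and> {a..b} \<subseteq> S;
        pairwise (\<lambda>(a, b) (c, d). disjnt {a<..<b} {c<..<d}) P;
        (\<Sum>(a, b)\<in>P. b - a) < \<delta>2\<rbrakk>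
        \<Longrightarrow> (\<Sum>(a, b)\<in>P. norm (g b - g a)) < e"
    by (rule absolutely_continuous_onE[OF g \<open>e > 0\<close>]) iprover
  have "(\<Sum>(a, b)\<in>P. norm (h b - h a)) < \<epsilon>"
    if P: "finite P" "\<forall>(a, b)\<in>P. a \<le> b \<and> {a..b} \<subseteq> S"
        "pairwise (\<lambda>(a, b) (c, d). disjnt {a<..<b} {c<..<d}) P"
        "(\<Sum>(a, b)\<in>P. b - a) < min \<delta>1 \<delta>2" for P :: "(real \<times> real) set"
  proof -
    have F: "(\<Sum>(a, b)\<in>P. norm (f b - f a)) < e" and G: "(\<Sum>(a, b)\<in>P. norm (g b - g a)) < e"
      using P by (intro \<delta>1(2) \<delta>2(2); simp)+
    have "(\<Sum>(a, b)\<in>P. norm (h b - h a))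
        \<le> (\<Sum>(a, b)\<in>P. (\<bar>L\<bar> + 1) * (norm (f b - f a) + norm (g b - g a)))"
    proof (rule sum_mono, clarify)
      fix a b assume "(a, b) \<in> P"
      then have "a \<in> S" "b \<in> S" using P(2) by fastforce+
      from L[OF this] show "norm (h b - h a) \<le> (\<bar>L\<bar> + 1) * (norm (f b - f a) + norm (g b - g a))"
        by (rule order_trans) (auto intro!: mult_right_mono)
    qed
    also have "\<dots> = (\<bar>L\<bar> + 1) * ((\<Sum>(a, b)\<in>P. norm (f b - f a)) + (\<Sum>(a, b)\<in>P. norm (g b - g a)))"
      by (simp add: sum_distrib_left[symmetric] sum.distrib case_prod_unfold)
    also have "\<dots> < (\<bar>L\<bar> + 1) * (e + e)"
      using F G by (intro mult_strict_left_mono) auto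
    also have "\<dots> = \<epsilon>" unfolding e_def field_sum_of_halves using abs_ge_zero[of L] by simp
    finally show ?thesis .
  qed
  then show "\<exists>\<delta>>0. \<forall>P::(real \<times> real) set.
        finite P \<and> (\<forall>(a, b)\<in>P. a \<le> b \<and> {a..b} \<subseteq> S) \<and>
        pairwise (\<lambda>(a, b) (c, d). disjnt {a<..<b} {c<..<d}) P \<and>
        (\<Sum>(a, b)\<in>P. b - a) < \<delta>
        \<longrightarrow> (\<Sum>(a, b)\<in>P. norm (h b - h a)) < \<epsilon>"
    using \<delta>1(1) \<delta>2(1) by (intro exI[of _ "min \<delta>1 \<delta>2"]) auto
qed

lemma absolutely_continuous_on_imp_continuous_on:
  assumes "absolutely_continuous_on {a..b} f"
  shows "continuous_on {a..b} f"
  unfolding continuous_on_iff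
proof (intro ballI allI impI)
  fix x \<epsilon> :: real assume x: "x \<in> {a..b}" and "\<epsilon> > 0"
  obtain \<delta> where \<delta>: "\<delta> > 0" "\<And>P::(real \<times> real) set.
        \<lbrakk>finite P; \<forall>(c, d)\<in>P. c \<le> d \<and> {c..d} \<subseteq> {a..b};
        pairwise (\<lambda>(a, b) (c, d). disjnt {a<..<b} {c<..<d}) P;
        (\<Sum>(a, b)\<in>P. b - a) < \<delta>\<rbrakk>
        \<Longrightarrow> (\<Sum>(a, b)\<in>P. norm (f b - f a)) < \<epsilon>"
    by (rule absolutely_continuous_onE[OF assms(1) \<open>\<epsilon> > 0\<close>]) iprover
  have "dist (f y) (f x) < \<epsilon>" if "y \<in> {a..b}" "dist y x < \<delta>" for y
    using \<delta>(2)[of "{(min x y, max x y)}"] that x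
    by (cases "x \<le> y") (auto simp: dist_norm norm_minus_commute min_def max_def)
  then show "\<exists>d>0. \<forall>x'\<in>{a..b}. dist x' x < d \<longrightarrow> dist (f x') (f x) < \<epsilon>"
    using \<delta>(1) by blast
qed

section \<open>Monotonicity of absolutely continuous functions with nonpositive derivative almost
  everywhere\<close>

lemma derivative_nonpos_local_increment:
  fixes h :: "real \<Rightarrow> real"
  assumes "(h has_vector_derivative v) (at x within S)" "v \<le> 0" "\<epsilon> > 0"
  obtains d where "d > 0" "\<And>c e. c \<in> S \<Longrightarrow> e \<in> S \<Longrightarrow> c \<le> x \<Longrightarrow> x \<le> e \<Longrightarrow> e - c < d \<Longrightarrow>
    h e - h c \<le> \<epsilon> * (e - c)"
proof -
  from assms(1,3) obtain d where d: "d > 0"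
    "\<And>y. y \<in> S \<Longrightarrow> norm (y - x) < d \<Longrightarrow> norm (h y - h x - (y - x) *\<^sub>R v) \<le> \<epsilon> * norm (y - x)"
    unfolding has_vector_derivative_def has_derivative_within_alt by metis
  have "h e - h c \<le> \<epsilon> * (e - c)" if "c \<in> S" "e \<in> S" "c \<le> x" "x \<le> e" "e - c < d" for c e
  proof -
    \<comment> \<open>The increments to the right and to the left of \<open>x\<close> are linearised
      separately, so that \<open>c\<close> and \<open>e\<close> may straddle \<open>x\<close>, as
      interval induction requires.\<close>
    have "h e - h x \<le> \<epsilon> * (e - x) + (e - x) * v" "h x - h c \<le> \<epsilon> * (x - c) - (c - x) * v"
      using d(2)[of e] d(2)[of c] that by (auto simp: abs_le_iff)
    moreover have "(e - x) * v \<le> 0" "(x - c) * v \<le> 0"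
      using that assms(2) by (auto intro: mult_nonneg_nonpos)
    ultimately show ?thesis by (simp add: algebra_simps)
  qed
  with d(1) that show thesis by blast
qed

text \<open>The exceptional set lies in a null set \<open>N\<close>. Outer regularity gives an open
  superset with small excess over \<open>N\<close>, and \<open>N\<close> itself adds no
  measure.\<close>

lemma AE_lebesgue_on_open_cover:
  fixes S :: "real set"
  assumes "AE t in lebesgue_on S. P t" "S \<in> sets lebesgue" "\<delta> > 0"
  obtains U where "open U" "{t \<in> S. \<not> P t} \<subseteq> U" "U \<in> lmeasurable" "measure lebesgue U < \<delta>"
proof -
  obtain N where N: "{t \<in> space (lebesgue_on S). \<not> P t} \<subseteq> N" "N \<in> null_sets (lebesgue_on S)"
    using assms(1) unfolding eventually_ae_filter by blast
  have N0: "N \<in> null_sets lebesgue"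
    using N(2) assms(2) by (auto simp: null_sets_restrict_space)
  obtain U where U: "open U" "N \<subseteq> U" "(U - N) \<in> lmeasurable" "emeasure lebesgue (U - N) < ennreal \<delta>"
    using sets_lebesgue_outer_open[of N \<delta>] N0 assms(3) by blast
  have UN: "U = (U - N) \<union> N" using U(2) by blast
  have UM: "U \<in> lmeasurable"
    using fmeasurable.Un[OF U(3) fmeasurableI_null_sets[OF N0]] UN by simp
  have "emeasure lebesgue U = emeasure lebesgue (U - N)"
    using U(3) N0 by (subst UN, intro emeasure_Un_null_set) auto
  then have "measure lebesgue U < \<delta>"
    using U(4) emeasure_eq_measure2[OF UM] by (metis ennreal_less_iff measure_nonneg)
  with UM show thesis
    using that U(1,2) N(1) by auto
qed

lemma sum_disjoint_intervals_le_measure: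
  assumes P: "finite P" "\<forall>(a, b)\<in>P. a \<le> b \<and> {a..b} \<subseteq> U"
    "pairwise (\<lambda>(a, b) (c, d). disjnt {a<..<b} {c<..<d}) P"
    and U: "U \<in> lmeasurable"
  shows "(\<Sum>(a, b)\<in>P. b - a) \<le> measure lebesgue U"
proof -
  have m: "\<And>p. {fst p<..<snd p::real} \<in> lmeasurable" by simp
  have "(\<Sum>(a, b)\<in>P. b - a) = (\<Sum>p\<in>P. measure lebesgue {fst p<..<snd p})"
    using P(2) by (intro sum.cong) auto
  also have "\<dots> = measure lebesgue (\<Union>p\<in>P. {fst p<..<snd p})"
    using P(1,3) m by (intro measure_UNION'[symmetric]) (auto simp: case_prod_unfold)
  also have "\<dots> \<le> measure lebesgue U"
    using P(1,2) U m by (intro measure_mono_fmeasurable) (fastforce intro!: sets.finite_UN)+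
  finally show ?thesis .
qed

lemma pairwise_Un_I:
  assumes "pairwise R A" "pairwise R B" "\<And>x y. x \<in> A \<Longrightarrow> y \<in> B \<Longrightarrow> R x y \<and> R y x"
  shows "pairwise R (A \<union> B)"
  using assms unfolding pairwise_def by blast

text \<open>By interval induction, up to an error \<open>\<epsilon> * (b - a)\<close>, the increment of \<open>h\<close> is carried by
  finitely many intervals inside an open set of small measure containing all the exceptional points,
  and absolute continuity makes this part small.\<close>

lemma absolutely_continuous_on_AE_nonpos_derivative_imp_le:
  fixes h :: "real \<Rightarrow> real"
  assumes ac: "absolutely_continuous_on {a..b} h" and "a \<le> b"
    and ae: "AE t in lebesgue_on {a..b}. \<exists>v\<le>0. (h has_vector_derivative v) (at t within {a..b})"
  shows "h b \<le> h a"
proof (rule field_le_epsilon)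
  fix e :: real assume "e > 0"
  \<comment> \<open>Splits \<open>e\<close> into the share \<open>\<epsilon> * (b - a)\<close> of
    the points with nonpositive derivative and the share \<open>\<epsilon>\<close> of the intervals
    inside \<open>U\<close>.\<close>
  define \<epsilon> where "\<epsilon> = e / (1 + (b - a))"
  have "\<epsilon> * (1 + (b - a)) = e" and \<epsilon>: "\<epsilon> > 0"
    using \<open>e > 0\<close> \<open>a \<le> b\<close> unfolding \<epsilon>_def by simp_all
  then have \<epsilon>e: "\<epsilon> * (b - a) + \<epsilon> = e" by (simp add: algebra_simps)
  obtain \<delta> where \<delta>: "\<delta> > 0" "\<And>P::(real \<times> real) set.
        \<lbrakk>finite P; \<forall>(c, d)\<in>P. c \<le> d \<and> {c..d} \<subseteq> {a..b};
        pairwise (\<lambda>(a, b) (c, d). disjnt {a<..<b} {c<..<d}) P;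
        (\<Sum>(a, b)\<in>P. b - a) < \<delta>\<rbrakk>
        \<Longrightarrow> (\<Sum>(a, b)\<in>P. norm (h b - h a)) < \<epsilon>"
    by (rule absolutely_continuous_onE[OF ac \<epsilon>]) iprover
  obtain U where U: "open U" "{t \<in> {a..b}. \<not> (\<exists>v\<le>0. (h has_vector_derivative v) (at t within {a..b}))} \<subseteq> U"
      "U \<in> lmeasurable" "measure lebesgue U < \<delta>"
    by (rule AE_lebesgue_on_open_cover[OF ae _ \<delta>(1)]) auto
  \<comment> \<open>The inclusion guard is needed because the induction also meets intervals that
    stick out of \<open>{a..b}\<close>. The strict \<open>r < s\<close> makes the families of two
    adjacent intervals disjoint as sets.\<close>
  define Q where "Q c d \<longleftrightarrow> ({c..d} \<subseteq> {a..b} \<longrightarrow> (\<exists>P. finite P \<and>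
      (\<forall>(r, s)\<in>P. r < s \<and> {r..s} \<subseteq> U \<inter> {c..d}) \<and>
      pairwise (\<lambda>(a, b) (c, d). disjnt {a<..<b} {c<..<d}) P \<and>
      h d - h c \<le> \<epsilon> * (d - c) + (\<Sum>(r, s)\<in>P. norm (h s - h r))))" for c d
  have "Q a b"
    using \<open>a \<le> b\<close>
  proof (induction rule: Bolzano)
    case (trans x y z)
    show ?case
      unfolding Q_def
    proof (intro impI)
      assume xz: "{x..z} \<subseteq> {a..b}"
      have xy: "{x..y} \<subseteq> {a..b}" and yz: "{y..z} \<subseteq> {a..b}"
        using xz trans(3,4) by auto
      obtain P1 where P1: "finite P1" "\<forall>(r, s)\<in>P1. r < s \<and> {r..s} \<subseteq> U \<inter> {x..y}"
         "pairwise (\<lambda>(a, b) (c, d). disjnt {a<..<b} {c<..<d}) P1"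
         "h y - h x \<le> \<epsilon> * (y - x) + (\<Sum>(r, s)\<in>P1. norm (h s - h r))"
        using trans(1) xy unfolding Q_def by (elim impE exE conjE)
      obtain P2 where P2: "finite P2" "\<forall>(r, s)\<in>P2. r < s \<and> {r..s} \<subseteq> U \<inter> {y..z}"
         "pairwise (\<lambda>(a, b) (c, d). disjnt {a<..<b} {c<..<d}) P2"
         "h z - h y \<le> \<epsilon> * (z - y) + (\<Sum>(r, s)\<in>P2. norm (h s - h r))"
        using trans(2) yz unfolding Q_def by (elim impE exE conjE)
      have P12: "s \<le> y" "y \<le> r'" if "(r, s) \<in> P1" "(r', s') \<in> P2" for r s r' s'
        using bspec[OF P1(2) that(1)] bspec[OF P2(2) that(2)] by auto
      have lt: "r < s" if "(r, s) \<in> P1" for r s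
        using bspec[OF P1(2) that] by simp
      have "P1 \<inter> P2 = {}"
      proof (rule equals0I, clarify)
        fix r s assume "(r, s) \<in> P1" "(r, s) \<in> P2"
        from P12[OF this] lt[OF this(1)] show False by simp
      qed
      then have "(\<Sum>(r, s)\<in>P1 \<union> P2. norm (h s - h r))
          = (\<Sum>(r, s)\<in>P1. norm (h s - h r)) + (\<Sum>(r, s)\<in>P2. norm (h s - h r))"
        using P1(1) P2(1) by (intro sum.union_disjoint)
      then have "h z - h x \<le> \<epsilon> * (z - x) + (\<Sum>(r, s)\<in>P1 \<union> P2. norm (h s - h r))"
        using P1(4) P2(4) by (simp add: algebra_simps)
      moreover have "\<forall>(r, s)\<in>P1 \<union> P2. r < s \<and> {r..s} \<subseteq> U \<inter> {x..z}"
        using P1(2) P2(2) trans(3,4) unfolding ball_Un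
        by (intro conjI ballI) (drule (1) bspec, auto simp: subset_iff)+
      moreover
      let ?R = "\<lambda>(a :: real, b) (c, d). disjnt {a<..<b} {c<..<d :: real}"
      have "disjnt {r<..<s} {r'<..<s'} \<and> disjnt {r'<..<s'} {r<..<s}"
        if "(r, s) \<in> P1" "(r', s') \<in> P2" for r s r' s'
        using P12[OF that] by (auto simp: disjnt_iff)
      then have D: "?R p q \<and> ?R q p" if "p \<in> P1" "q \<in> P2" for p q
        using that by (cases p; cases q) simp
      have "pairwise (\<lambda>(a, b) (c, d). disjnt {a<..<b} {c<..<d}) (P1 \<union> P2)"
        by (rule pairwise_Un_I[OF P1(3) P2(3) D])
      ultimately show "\<exists>P. finite P \<and>
        (\<forall>(r, s)\<in>P. r < s \<and> {r..s} \<subseteq> U \<inter> {x..z}) \<and>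
        pairwise (\<lambda>(a, b) (c, d). disjnt {a<..<b} {c<..<d}) P \<and>
        h z - h x \<le> \<epsilon> * (z - x) + (\<Sum>(r, s)\<in>P. norm (h s - h r))"
        using P1(1) P2(1) by (intro exI[of _ "P1 \<union> P2"] conjI) (rule finite_UnI)
    qed
  next
    case (local x)
    show ?case
    proof (cases "x \<in> U")
      case True
      then obtain d where d: "d > 0" "ball x d \<subseteq> U"
        using U(1) open_contains_ball by blast
      have "Q c e" if "c \<le> x" "x \<le> e" "e - c < d" for c e
      proof (cases "c = e")
        case True
        then show ?thesis unfolding Q_def by (auto intro!: exI[of _ "{}"])
      next
        case False
        \<comment> \<open>Near a point of \<open>U\<close> the single interval \<open>(c, e)\<close>
          carries the whole increment.\<close>
        have "{c..e} \<subseteq> ball x d" using that by (auto simp: dist_real_def)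
        then show ?thesis unfolding Q_def using False that d \<epsilon>
          by (intro impI exI[of _ "{(c, e)}"]) (auto intro: add_increasing)
      qed
      then show ?thesis using d(1) by blast
    next
      case False
      then obtain v where v: "(h has_vector_derivative v) (at x within {a..b})" "v \<le> 0"
        using U(2) local by auto
      obtain d where d: "d > 0" "\<And>c e. c \<in> {a..b} \<Longrightarrow> e \<in> {a..b} \<Longrightarrow> c \<le> x \<Longrightarrow> x \<le> e \<Longrightarrow> e - c < d \<Longrightarrow>
          h e - h c \<le> \<epsilon> * (e - c)"
        using derivative_nonpos_local_increment[OF v \<epsilon>] by metis
      \<comment> \<open>Near a point outside \<open>U\<close> the derivative bound alone suffices,
        and the family is empty.\<close>
      have "Q c e" if "c \<le> x" "x \<le> e" "e - c < d" for c e
        unfolding Q_def using d(2)[of c e] that by (intro impI exI[of _ "{}"]) auto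
      then show ?thesis using d(1) by blast
    qed
  qed
  then obtain P where P: "finite P" "\<forall>(r, s)\<in>P. r < s \<and> {r..s} \<subseteq> U \<inter> {a..b}"
      "pairwise (\<lambda>(a, b) (c, d). disjnt {a<..<b} {c<..<d}) P"
      "h b - h a \<le> \<epsilon> * (b - a) + (\<Sum>(r, s)\<in>P. norm (h s - h r))"
    unfolding Q_def by (elim impE exE conjE) simp_all
  have "(\<Sum>(r, s)\<in>P. s - r) \<le> measure lebesgue U"
    using P U(3) by (intro sum_disjoint_intervals_le_measure) auto
  then have "(\<Sum>(r, s)\<in>P. norm (h s - h r)) < \<epsilon>"
    using P U(4) by (intro \<delta>(2)) auto
  then show "h b \<le> h a + e"
    using P(4) \<epsilon>e by simp
qed

section \<open>Closure properties of absolute continuity and the derivative of a squared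
  norm\<close>

lemma absolutely_continuous_on_const: "absolutely_continuous_on S (\<lambda>_. c)"
  unfolding absolutely_continuous_on_def by (auto intro: exI[of _ 1])

lemma absolutely_continuous_on_add:
  assumes "absolutely_continuous_on S f" "absolutely_continuous_on S g"
  shows "absolutely_continuous_on S (\<lambda>t. f t + g t)"
  by (rule absolutely_continuous_on_dominated[OF assms, of _ 1])
    (simp add: add_diff_add norm_triangle_ineq)

lemma absolutely_continuous_on_diff:
  assumes "absolutely_continuous_on S f" "absolutely_continuous_on S g"
  shows "absolutely_continuous_on S (\<lambda>t. f t - g t)"
proof (rule absolutely_continuous_on_dominated[OF assms])
  fix s t
  have "norm ((f t - f s) - (g t - g s)) \<le> 1 * (norm (f t - f s) + norm (g t - g s))"
    using norm_triangle_ineq4 by simp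
  then show "norm (f t - g t - (f s - g s)) \<le> 1 * (norm (f t - f s) + norm (g t - g s))"
    by (simp add: algebra_simps)
qed

lemma absolutely_continuous_on_cmult:
  fixes f :: "real \<Rightarrow> real"
  assumes "absolutely_continuous_on S f"
  shows "absolutely_continuous_on S (\<lambda>t. c * f t)"
  by (rule absolutely_continuous_on_dominated[OF assms absolutely_continuous_on_const, of _ "\<bar>c\<bar>"])
    (simp add: abs_mult right_diff_distrib[symmetric])

text \<open>On a compact interval \<open>f\<close> stays in a ball of some radius \<open>R\<close>,
  on which the squared norm is Lipschitz with constant \<open>2 * R\<close>.\<close>

lemma absolutely_continuous_on_norm_square:
  fixes f :: "real \<Rightarrow> 'a::real_normed_vector"
  assumes "absolutely_continuous_on {a..b} f"
  shows "absolutely_continuous_on {a..b} (\<lambda>t. (norm (f t))\<^sup>2)"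
proof -
  have "compact (f ` {a..b})"
    using absolutely_continuous_on_imp_continuous_on[OF assms] by (simp add: compact_continuous_image)
  then obtain R where R: "\<And>t. t \<in> {a..b} \<Longrightarrow> norm (f t) \<le> R"
    by (meson bounded_iff compact_imp_bounded image_eqI)
  show ?thesis
  proof (rule absolutely_continuous_on_dominated[OF assms absolutely_continuous_on_const, of _ "2 * R"])
    fix s t assume st: "s \<in> {a..b}" "t \<in> {a..b}"
    have "\<bar>(norm (f t))\<^sup>2 - (norm (f s))\<^sup>2\<bar> = \<bar>norm (f t) + norm (f s)\<bar> * \<bar>norm (f t) - norm (f s)\<bar>"
      by (simp only: power2_eq_square square_diff_square_factored abs_mult)
    also have "\<dots> \<le> (2 * R) * norm (f t - f s)"
    proof (intro mult_mono norm_triangle_ineq3)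
      show "\<bar>norm (f t) + norm (f s)\<bar> \<le> 2 * R" "0 \<le> 2 * R"
        using R[OF st(1)] R[OF st(2)] norm_ge_zero[of "f t"] norm_ge_zero[of "f s"] by linarith+
    qed simp
    finally show "norm ((norm (f t))\<^sup>2 - (norm (f s))\<^sup>2) \<le> 2 * R * (norm (f t - f s) + norm (0 - 0))"
      by simp
  qed
qed

lemma has_vector_derivative_norm_square:
  fixes f :: "real \<Rightarrow> 'a::real_inner"
  assumes "(f has_vector_derivative v) (at t within S)"
  shows "((\<lambda>t. (norm (f t))\<^sup>2) has_vector_derivative 2 * (f t \<bullet> v)) (at t within S)"
  using bounded_bilinear.has_vector_derivative[OF bounded_bilinear_inner assms assms]
  by (simp add: power2_norm_eq_inner inner_commute)

section \<open>Normal cones of polyhedra with a Slater point\<close>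

text \<open>If the polyhedron contains the ball of radius \<open>\<eta> / B\<close> around \<open>z\<close>, normal vectors
  point away from \<open>z\<close> quantitatively.\<close>

lemma normal_cone_polyhedron_inner_ge:
  fixes p :: "'i \<Rightarrow> 'a::real_inner"
  assumes z: "\<And>i. p i \<bullet> z + \<eta> \<le> \<beta> i" and B: "\<And>i. norm (p i) \<le> B" "B > 0" and "\<eta> > 0"
    and w: "w \<in> normal_cone {y. \<forall>i. p i \<bullet> y \<le> \<beta> i} x"
  shows "\<eta> / B * norm w \<le> w \<bullet> (x - z)"
proof (cases "w = 0")
  case False
  \<comment> \<open>The vector \<open>r *\<^sub>R w\<close> has norm \<open>\<eta> / B\<close>, so
    adding it to \<open>z\<close> uses up at most the slack \<open>\<eta>\<close>. Testing normality
    at this point gives the claim.\<close>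
  define r where "r = \<eta> / (B * norm w)"
  have "r \<ge> 0" using assms by (simp add: r_def)
  have "p i \<bullet> (z + r *\<^sub>R w) \<le> \<beta> i" for i
  proof -
    have "p i \<bullet> w \<le> norm (p i) * norm w" by (rule norm_cauchy_schwarz)
    also have "\<dots> \<le> B * norm w" by (intro mult_right_mono B) simp
    finally have "r * (p i \<bullet> w) \<le> r * (B * norm w)" using \<open>r \<ge> 0\<close> by (rule mult_left_mono)
    also have "\<dots> = \<eta>" using False B by (simp add: r_def)
    finally show ?thesis using z[of i] by (simp add: inner_add_right)
  qed
  then have "w \<bullet> (z + r *\<^sub>R w - x) \<le> 0"
    using w by (auto simp: normal_cone_def split: if_splits)
  moreover have "r * (w \<bullet> w) = \<eta> / B * norm w"
    using False by (simp add: r_def dot_square_norm power2_eq_square)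
  ultimately show ?thesis by (simp add: inner_add_right inner_diff_right)
qed simp

text \<open>Moving \<open>x'\<close> by the fraction \<open>\<epsilon> / (\<epsilon> + \<eta>)\<close> towards the Slater point \<open>z\<close>,
  where \<open>\<epsilon> = e * (1 + norm x')\<close>, makes it feasible for the unprimed constraints.\<close>

lemma normal_cone_polyhedron_inner_le_perturbed:
  fixes p p' :: "'i \<Rightarrow> 'a::real_inner"
  assumes z: "\<And>i. p i \<bullet> z + \<eta> \<le> \<beta> i" and "\<eta> > 0"
    and w: "w \<in> normal_cone {y. \<forall>i. p i \<bullet> y \<le> \<beta> i} x"
    and x': "\<And>i. p' i \<bullet> x' \<le> \<beta>' i"
    and e: "\<And>i. norm (p i - p' i) \<le> e" "\<And>i. \<bar>\<beta> i - \<beta>' i\<bar> \<le> e" "e \<ge> 0"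
  shows "w \<bullet> (x' - x) \<le> norm w * (e * (1 + norm x') / \<eta> * norm (x' - z))"
proof -
  define \<epsilon> where "\<epsilon> = e * (1 + norm x')"
  define l where "l = \<epsilon> / (\<epsilon> + \<eta>)"
  have "\<epsilon> \<ge> 0" using e(3) by (simp add: \<epsilon>_def)
  \<comment> \<open>The last equation is the reason for this \<open>l\<close>: the remaining
    violation of \<open>x'\<close> equals the slack contributed by \<open>z\<close>. The bound by
    \<open>\<epsilon> / \<eta>\<close> makes the displacement linear in \<open>e\<close>.\<close>
  then have l: "0 \<le> l" "l \<le> 1" "l \<le> \<epsilon> / \<eta>" "(1 - l) * \<epsilon> = l * \<eta>"
    using \<open>\<eta> > 0\<close> unfolding l_def by (auto simp: field_simps intro!: divide_left_mono)
  have "p i \<bullet> (x' - l *\<^sub>R (x' - z)) \<le> \<beta> i" for i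
  proof -
    have "(p i - p' i) \<bullet> x' \<le> norm (p i - p' i) * norm x'" by (rule norm_cauchy_schwarz)
    also have "\<dots> \<le> e * norm x'" by (intro mult_right_mono e) simp
    finally have "p i \<bullet> x' \<le> \<beta> i + \<epsilon>"
      using x'[of i] e(2)[of i] by (simp add: \<epsilon>_def inner_diff_left algebra_simps)
    then have "(1 - l) * (p i \<bullet> x') \<le> (1 - l) * (\<beta> i + \<epsilon>)"
      using l by (intro mult_left_mono) auto
    moreover have "l * (p i \<bullet> z) \<le> l * (\<beta> i - \<eta>)"
      using l(1) z[of i] by (intro mult_left_mono) auto
    ultimately show ?thesis
      using l(4) by (simp add: inner_diff_right algebra_simps)
  qed
  then have "w \<bullet> (x' - l *\<^sub>R (x' - z) - x) \<le> 0"
    using w by (auto simp: normal_cone_def split: if_splits)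
  then have "w \<bullet> (x' - x) \<le> l * (w \<bullet> (x' - z))"
    by (simp add: inner_diff_right algebra_simps)
  also have "\<dots> \<le> l * (norm w * norm (x' - z))"
    using l(1) by (intro mult_left_mono norm_cauchy_schwarz)
  also have "\<dots> \<le> \<epsilon> / \<eta> * (norm w * norm (x' - z))"
    using l(3) by (intro mult_right_mono) auto
  finally show ?thesis by (simp add: \<epsilon>_def mult_ac)
qed

section \<open>Solutions of the sweeping process\<close>

text \<open>The conjunct \<open>t \<in> {c..d}\<close> is carried along so that pointwise arguments
  under the almost-everywhere quantifier can use it.\<close>

lemma sweeping_solution_AE_subinterval:
  assumes "sweeping_solution T p x0 x" "{c..d} \<subseteq> {0..T}"
  shows "AE t in lebesgue_on {c..d}. t \<in> {c..d} \<and> (\<exists>v. (x has_vector_derivative v) (at t within {c..d}) \<and>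
        - v \<in> normal_cone (moving_polyhedron p t) (x t))"
proof -
  have "AE t in lebesgue. t \<in> {0..T} \<longrightarrow> (\<exists>v. (x has_vector_derivative v) (at t within {0..T}) \<and>
        - v \<in> normal_cone (moving_polyhedron p t) (x t))"
    using assms(1) unfolding sweeping_solution_def by (subst (asm) AE_restrict_space_iff) auto
  then have "AE t in lebesgue. t \<in> {c..d} \<longrightarrow> t \<in> {c..d} \<and> (\<exists>v. (x has_vector_derivative v) (at t within {c..d}) \<and>
        - v \<in> normal_cone (moving_polyhedron p t) (x t))"
    by (rule AE_mp) (use assms(2) in \<open>fastforce intro: has_vector_derivative_within_subset intro!: AE_I2\<close>)
  then show ?thesis by (subst AE_restrict_space_iff) auto
qed

lemma sweeping_solution_absolutely_continuous:
  assumes "sweeping_solution T p x0 x" "{c..d} \<subseteq> {0..T}"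
  shows "absolutely_continuous_on {c..d} x"
  using assms unfolding sweeping_solution_def by (blast intro: absolutely_continuous_on_subset)

text \<open>Since \<open>z\<close> stays feasible, testing the normal vector \<open>- v\<close>
  against it shows that the squared distance to \<open>z\<close> has nonpositive derivative almost
  everywhere.\<close>

lemma sweeping_solution_dist_le:
  assumes x: "sweeping_solution T p x0 x" and sub: "{c..d} \<subseteq> {0..T}"
    and z: "\<And>t. t \<in> {c..d} \<Longrightarrow> z \<in> moving_polyhedron p t" and t: "t \<in> {c..d}"
  shows "norm (x t - z) \<le> norm (x c - z)"
proof -
  have sub': "{c..t} \<subseteq> {0..T}" using sub t by auto
  have "(norm (x t - z))\<^sup>2 \<le> (norm (x c - z))\<^sup>2"
  proof (rule absolutely_continuous_on_AE_nonpos_derivative_imp_le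
      [where h = "\<lambda>t. (norm (x t - z))\<^sup>2" and a = c and b = t])
    show "absolutely_continuous_on {c..t} (\<lambda>t. (norm (x t - z))\<^sup>2)"
      by (intro absolutely_continuous_on_norm_square absolutely_continuous_on_diff
          absolutely_continuous_on_const sweeping_solution_absolutely_continuous[OF x sub'])
    show "AE s in lebesgue_on {c..t}. \<exists>v\<le>0. ((\<lambda>t. (norm (x t - z))\<^sup>2) has_vector_derivative v) (at s within {c..t})"
      using sweeping_solution_AE_subinterval[OF x sub']
    proof (rule AE_mp, intro AE_I2 impI, elim conjE exE)
      fix s v assume s: "s \<in> {c..t}" and v: "(x has_vector_derivative v) (at s within {c..t})"
        "- v \<in> normal_cone (moving_polyhedron p s) (x s)"
      have "z \<in> moving_polyhedron p s" using z t s by auto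
      then have "(x s - z) \<bullet> v \<le> 0"
        using v(2) by (auto simp: normal_cone_def inner_diff inner_commute algebra_simps split: if_splits)
      moreover have "((\<lambda>t. x t - z) has_vector_derivative v) (at s within {c..t})"
        using v(1) by (auto intro!: derivative_eq_intros)
      note has_vector_derivative_norm_square[OF this]
      ultimately show "\<exists>v\<le>0. ((\<lambda>t. (norm (x t - z))\<^sup>2) has_vector_derivative v) (at s within {c..t})"
        by (intro exI[of _ "2 * ((x s - z) \<bullet> v)"]) auto
    qed
  qed (use t in auto)
  then show ?thesis by (rule power2_le_imp_le) simp
qed

text \<open>A pointwise form free of suprema. It is used twice: with a fixed radius around the
  reference control, obtained from \<open>norm_11\<close>, and with \<open>e\<close> between two
  controls, obtained from \<open>norm_inf\<close>.\<close>

definition uniformly_close ::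
    "real \<Rightarrow> real \<Rightarrow> (real \<Rightarrow> 'a::real_normed_vector ^ 'm) \<times> (real \<Rightarrow> real ^ 'm)
       \<Rightarrow> (real \<Rightarrow> 'a ^ 'm) \<times> (real \<Rightarrow> real ^ 'm) \<Rightarrow> bool" where
  "uniformly_close T e = (\<lambda>(u, b) (u', b').
     \<forall>t\<in>{0..T}. \<forall>i. norm (u t $ i - u' t $ i) \<le> e \<and> \<bar>b t $ i - b' t $ i\<bar> \<le> e)"

text \<open>The increment of \<open>norm (x t - x' t)\<close> squared is compensated by the decrease of the distances
  of \<open>x\<close> and \<open>x'\<close> to a common interior point \<open>z\<close>, which controls the velocities.\<close>

lemma sweeping_solutions_local_estimate:
  fixes u u' :: "real \<Rightarrow> 'a::real_inner ^ 'm" and b b' :: "real \<Rightarrow> real ^ 'm"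
  assumes x: "sweeping_solution T (u, b) x0 x" and x': "sweeping_solution T (u', b') x0' x'"
    and sub: "{c..d} \<subseteq> {0..T}" and t: "t \<in> {c..d}"
    and z: "\<And>t i. t \<in> {c..d} \<Longrightarrow> u t $ i \<bullet> z + \<eta> \<le> b t $ i"
      "\<And>t i. t \<in> {c..d} \<Longrightarrow> u' t $ i \<bullet> z + \<eta> \<le> b' t $ i"
    and B: "\<And>t i. t \<in> {c..d} \<Longrightarrow> norm (u t $ i) \<le> B" "\<And>t i. t \<in> {c..d} \<Longrightarrow> norm (u' t $ i) \<le> B"
    and pos: "B > 0" "\<eta> > 0" "e \<ge> 0" and close: "uniformly_close T e (u, b) (u', b')"
  shows "norm (x t) \<le> norm (x c) + 2 * norm z" "norm (x' t) \<le> norm (x' c) + 2 * norm z"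
    "(norm (x t - x' t))\<^sup>2 \<le> (norm (x c - x' c))\<^sup>2
       + 2 * B * (1 + 2 * norm z) ^ 4 / \<eta>\<^sup>2 * (1 + norm (x c) + norm (x' c)) ^ 4 * e"
proof -
  have zC: "z \<in> moving_polyhedron (u, b) t" "z \<in> moving_polyhedron (u', b') t" if "t \<in> {c..d}" for t
    using z[OF that] pos(2) by (auto simp: moving_polyhedron_def) (smt (verit))+
  have dz: "norm (x t - z) \<le> norm (x c - z)" "norm (x' t - z) \<le> norm (x' c - z)" if "t \<in> {c..d}" for t
    using sweeping_solution_dist_le[OF x sub zC(1) that] sweeping_solution_dist_le[OF x' sub zC(2) that]
    by auto
  have M: "norm (x t) \<le> norm (x c) + 2 * norm z" "norm (x' t) \<le> norm (x' c) + 2 * norm z"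
    if "t \<in> {c..d}" for t
    using dz[OF that] norm_triangle_ineq4[of "x c" z] norm_triangle_ineq2[of "x t" z]
      norm_triangle_ineq4[of "x' c" z] norm_triangle_ineq2[of "x' t" z] by auto
  show "norm (x t) \<le> norm (x c) + 2 * norm z" "norm (x' t) \<le> norm (x' c) + 2 * norm z"
    by (fact M[OF t])+
  define S where "S = 1 + norm (x c) + norm (x' c)"
  \<comment> \<open>A common bound for the norms occurring on the interval. The product form keeps
    the starting points inside \<open>S\<close>, so the final constant separates into a factor
    depending on \<open>z\<close>, \<open>B\<close>, \<open>\<eta>\<close> and the factor
    \<open>S ^ 4\<close>.\<close>
  define Q where "Q = (1 + 2 * norm z) * S"
  have "S \<ge> 1" by (simp add: S_def)
  then have "2 * norm z * 1 \<le> 2 * norm z * S" by (intro mult_left_mono) auto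
  then have Q: "S + 2 * norm z \<le> Q" by (simp add: Q_def algebra_simps)
  then have "Q \<ge> 0" using \<open>S \<ge> 1\<close> norm_ge_zero[of z] by linarith
  have dQ: "norm (x t - z) \<le> Q" "norm (x' t - z) \<le> Q" "1 + norm (x t) \<le> Q" "1 + norm (x' t) \<le> Q"
    if "t \<in> {c..d}" for t
    using dz[OF that] M[OF that] Q norm_triangle_ineq4[of "x c" z] norm_triangle_ineq4[of "x' c" z]
      norm_ge_zero[of z] norm_ge_zero[of "x c"] norm_ge_zero[of "x' c"] unfolding S_def by linarith+
  \<comment> \<open>Bounds the factor of \<open>norm w\<close> in
    \<open>normal_cone_polyhedron_inner_le_perturbed\<close>, for either solution tested against the
    other.\<close>
  define k where "k = Q\<^sup>2 * e / \<eta>"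
  \<comment> \<open>Chosen so that \<open>K * (\<eta> / B) = k\<close>: the weighted decrease of the
    squared distances to \<open>z\<close> then absorbs the errors \<open>k * norm v\<close> and
    \<open>k * norm v'\<close>.\<close>
  define K where "K = k * B / \<eta>"
  have "k \<ge> 0" "K \<ge> 0" using pos by (simp_all add: k_def K_def)
  have sub': "{c..t} \<subseteq> {0..T}" using sub t by auto
  define h where "h = (\<lambda>t. (norm (x t - x' t))\<^sup>2 + K * ((norm (x t - z))\<^sup>2 + (norm (x' t - z))\<^sup>2))"
  have "h t \<le> h c"
  proof (rule absolutely_continuous_on_AE_nonpos_derivative_imp_le[where h = h and a = c and b = t])
    show "absolutely_continuous_on {c..t} h"
      unfolding h_def
      by (intro absolutely_continuous_on_norm_square absolutely_continuous_on_diff absolutely_continuous_on_add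
          absolutely_continuous_on_const absolutely_continuous_on_cmult
          sweeping_solution_absolutely_continuous[OF x sub'] sweeping_solution_absolutely_continuous[OF x' sub'])
    show "AE s in lebesgue_on {c..t}. \<exists>v\<le>0. (h has_vector_derivative v) (at s within {c..t})"
    proof (rule AE_mp[OF AE_conjI[OF sweeping_solution_AE_subinterval[OF x sub']
          sweeping_solution_AE_subinterval[OF x' sub']]], intro AE_I2 impI, elim conjE exE)
      fix s v v'
      assume "s \<in> {c..t}" and v: "(x has_vector_derivative v) (at s within {c..t})"
        "- v \<in> normal_cone (moving_polyhedron (u, b) s) (x s)"
        and v': "(x' has_vector_derivative v') (at s within {c..t})"
        "- v' \<in> normal_cone (moving_polyhedron (u', b') s) (x' s)"
      have s: "s \<in> {c..d}" "s \<in> {0..T}" using \<open>s \<in> {c..t}\<close> t sub by auto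
      have xC: "u s $ i \<bullet> x s \<le> b s $ i" "u' s $ i \<bullet> x' s \<le> b' s $ i" for i
        using v(2) v'(2) by (auto simp: normal_cone_def moving_polyhedron_def split: if_splits)
      have cl: "norm (u s $ i - u' s $ i) \<le> e" "\<bar>b s $ i - b' s $ i\<bar> \<le> e"
        "norm (u' s $ i - u s $ i) \<le> e" "\<bar>b' s $ i - b s $ i\<bar> \<le> e" for i
        using close s(2) by (auto simp: uniformly_close_def norm_minus_commute abs_minus_commute)
      have C: "moving_polyhedron (w, g) s = {y. \<forall>i. w s $ i \<bullet> y \<le> g s $ i}"
        for w :: "real \<Rightarrow> 'a ^ 'm" and g
        by (simp add: moving_polyhedron_def)
      have kb: "e * (1 + norm y) / \<eta> * norm (y - z) \<le> k" if "1 + norm y \<le> Q" "norm (y - z) \<le> Q" for y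
      proof -
        have "(1 + norm y) * norm (y - z) \<le> Q * Q"
          using that \<open>Q \<ge> 0\<close> by (intro mult_mono) auto
        then have "e / \<eta> * ((1 + norm y) * norm (y - z)) \<le> e / \<eta> * (Q * Q)"
          using pos by (intro mult_left_mono) auto
        then show ?thesis by (simp add: k_def power2_eq_square mult_ac)
      qed
      \<comment> \<open>Equal polyhedra would give the bound 0 by monotonicity of the normal cone.
        Here \<open>x' s\<close> is only nearly feasible for \<open>(u, b)\<close>, at a cost
        proportional to \<open>e\<close>; the roles are exchanged afterwards.\<close>
      have "- v \<bullet> (x' s - x s) \<le> norm (- v) * (e * (1 + norm (x' s)) / \<eta> * norm (x' s - z))"
        by (rule normal_cone_polyhedron_inner_le_perturbed[OF z(1)[OF s(1)] pos(2) v(2)[unfolded C] xC(2) cl(1,2) pos(3)])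
      also have "\<dots> \<le> norm v * k"
        unfolding norm_minus_cancel by (intro mult_left_mono kb[OF dQ(4,2)[OF s(1)]]) simp
      finally have 1: "v \<bullet> (x s - x' s) \<le> norm v * k" by (simp add: inner_diff_right)
      have "- v' \<bullet> (x s - x' s) \<le> norm (- v') * (e * (1 + norm (x s)) / \<eta> * norm (x s - z))"
        by (rule normal_cone_polyhedron_inner_le_perturbed[OF z(2)[OF s(1)] pos(2) v'(2)[unfolded C] xC(1) cl(3,4) pos(3)])
      also have "\<dots> \<le> norm v' * k"
        unfolding norm_minus_cancel by (intro mult_left_mono kb[OF dQ(3,1)[OF s(1)]]) simp
      finally have 2: "- (v' \<bullet> (x s - x' s)) \<le> norm v' * k" by (simp add: inner_diff_right)
      have "\<eta> / B * norm (- v) \<le> - v \<bullet> (x s - z)"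
        by (rule normal_cone_polyhedron_inner_ge[OF z(1)[OF s(1)] B(1)[OF s(1)] pos(1,2) v(2)[unfolded C]])
      then have 3: "norm v * k \<le> - (K * ((x s - z) \<bullet> v))"
        using mult_left_mono[OF _ \<open>K \<ge> 0\<close>, of "\<eta> / B * norm v"] pos
        by (fastforce simp: K_def inner_commute mult_ac)
      have "\<eta> / B * norm (- v') \<le> - v' \<bullet> (x' s - z)"
        by (rule normal_cone_polyhedron_inner_ge[OF z(2)[OF s(1)] B(2)[OF s(1)] pos(1,2) v'(2)[unfolded C]])
      then have 4: "norm v' * k \<le> - (K * ((x' s - z) \<bullet> v'))"
        using mult_left_mono[OF _ \<open>K \<ge> 0\<close>, of "\<eta> / B * norm v'"] pos
        by (fastforce simp: K_def inner_commute mult_ac)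
      \<comment> \<open>The left side is the derivative of \<open>h\<close>. The upper bounds
        \<open>1\<close> and \<open>2\<close> on the separation of the solutions cancel against the
        decrease rates \<open>3\<close> and \<open>4\<close>.\<close>
      have "2 * ((x s - x' s) \<bullet> (v - v')) + K * (2 * ((x s - z) \<bullet> v) + 2 * ((x' s - z) \<bullet> v')) \<le> 0"
      proof -
        have "(x s - x' s) \<bullet> (v - v') = v \<bullet> (x s - x' s) - v' \<bullet> (x s - x' s)"
          by (simp only: inner_diff_right inner_commute)
        moreover have "K * (2 * p + 2 * q) = 2 * (K * p) + 2 * (K * q)" for p q
          by (simp add: algebra_simps)
        moreover have "2 * (a - b) + (2 * p + 2 * q) \<le> 0"
          if "a \<le> n" "- b \<le> n'" "n \<le> - p" "n' \<le> - q" for a b n n' p q :: real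
          using that by argo
        note this[OF 1 2 3 4]
        ultimately show ?thesis by simp
      qed
      moreover have "(h has_vector_derivative
          (2 * ((x s - x' s) \<bullet> (v - v')) + K * (2 * ((x s - z) \<bullet> v) + 2 * ((x' s - z) \<bullet> v')))) (at s within {c..t})"
        unfolding h_def
        by (intro has_vector_derivative_add has_vector_derivative_mult_right has_vector_derivative_norm_square
            has_vector_derivative_diff v(1) v'(1))
          (use v(1) v'(1) in \<open>auto intro!: derivative_eq_intros\<close>)
      ultimately show "\<exists>v\<le>0. (h has_vector_derivative v) (at s within {c..t})"
        by blast
    qed
  qed (use t in auto)
  moreover have "0 \<le> K * ((norm (x t - z))\<^sup>2 + (norm (x' t - z))\<^sup>2)"
    using \<open>K \<ge> 0\<close> by simp
  \<comment> \<open>\<open>K\<close> already contains \<open>Q\<^sup>2\<close>, and the squared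
    distances at \<open>c\<close> contribute another \<open>Q\<^sup>2\<close>; this is the origin of
    the fourth powers.\<close>
  moreover have "K * ((norm (x c - z))\<^sup>2 + (norm (x' c - z))\<^sup>2) \<le> K * (Q\<^sup>2 + Q\<^sup>2)"
    using t \<open>K \<ge> 0\<close> dQ(1,2)[of c] by (intro mult_left_mono add_mono power_mono) auto
  ultimately have "(norm (x t - x' t))\<^sup>2 \<le> (norm (x c - x' c))\<^sup>2 + K * (Q\<^sup>2 + Q\<^sup>2)"
    by (simp add: h_def)
  also have "K * (Q\<^sup>2 + Q\<^sup>2) = 2 * B * (1 + 2 * norm z) ^ 4 / \<eta>\<^sup>2 * (1 + norm (x c) + norm (x' c)) ^ 4 * e"
    unfolding K_def k_def Q_def S_def[symmetric]
    by (simp add: power2_eq_square power4_eq_xxxx mult_ac)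
  finally show "(norm (x t - x' t))\<^sup>2 \<le> (norm (x c - x' c))\<^sup>2
       + 2 * B * (1 + 2 * norm z) ^ 4 / \<eta>\<^sup>2 * (1 + norm (x c) + norm (x' c)) ^ 4 * e" .
qed

section \<open>Control pairs\<close>

lemma has_weak_deriv_weak_deriv:
  assumes "f \<in> W11 T"
  shows "has_weak_deriv T f (weak_deriv T f)"
  using assms unfolding W11_def weak_deriv_def mem_Collect_eq by (rule someI_ex)

text \<open>Passes to one integrable function on the whole line, extended by zero, so that a change
  of the upper limit only changes an indicator. Norm bounds and dominated convergence then apply
  directly.\<close>

lemma has_weak_deriv_eq_integral:
  assumes "has_weak_deriv T f g"
  shows "integrable lebesgue (\<lambda>s. indicator {0..T} s *\<^sub>R g s)"
    and "t \<in> {0..T} \<Longrightarrow> f t = f 0 + (\<integral>s. indicator {0..t} s *\<^sub>R (indicator {0..T} s *\<^sub>R g s) \<partial>lebesgue)"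
proof -
  show "integrable lebesgue (\<lambda>s. indicator {0..T} s *\<^sub>R g s)"
    using assms unfolding has_weak_deriv_def by (subst (asm) integrable_restrict_space) auto
  assume t: "t \<in> {0..T}"
  have "integral\<^sup>L (lebesgue_on {0..t}) g = (\<integral>s. indicator {0..t} s *\<^sub>R g s \<partial>lebesgue)"
    by (rule integral_restrict_space) auto
  also have "\<dots> = (\<integral>s. indicator {0..t} s *\<^sub>R (indicator {0..T} s *\<^sub>R g s) \<partial>lebesgue)"
    using t by (intro Bochner_Integration.integral_cong) (auto simp: indicator_def)
  finally have eq: "integral\<^sup>L (lebesgue_on {0..t}) g
      = (\<integral>s. indicator {0..t} s *\<^sub>R (indicator {0..T} s *\<^sub>R g s) \<partial>lebesgue)" .
  have "f t = f 0 + integral\<^sup>L (lebesgue_on {0..t}) g"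
    using assms t unfolding has_weak_deriv_def by blast
  then show "f t = f 0 + (\<integral>s. indicator {0..t} s *\<^sub>R (indicator {0..T} s *\<^sub>R g s) \<partial>lebesgue)"
    by (simp only: eq)
qed

lemma has_weak_deriv_integrable:
  assumes "has_weak_deriv T f g" "t \<in> {0..T}"
  shows "integrable (lebesgue_on {0..t}) g"
proof -
  have "integrable lebesgue (\<lambda>s. indicator {0..t} s *\<^sub>R (indicator {0..T} s *\<^sub>R g s))"
    by (rule integrable_mult_indicator) (auto intro: has_weak_deriv_eq_integral(1)[OF assms(1)])
  also have "(\<lambda>s. indicator {0..t} s *\<^sub>R (indicator {0..T} s *\<^sub>R g s)) = (\<lambda>s. indicator {0..t} s *\<^sub>R g s)"
    using assms(2) by (auto simp: indicator_def)
  finally show ?thesis by (subst integrable_restrict_space) auto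
qed

text \<open>The right side is the contribution of one component to \<open>norm_11\<close>, which is
  how that norm comes to dominate uniform distances.\<close>

lemma W11_norm_le:
  assumes "f \<in> W11 T" "t \<in> {0..T}"
  shows "norm (f t) \<le> norm (f 0) + integral\<^sup>L (lebesgue_on {0..T}) (\<lambda>t. norm (weak_deriv T f t))"
proof -
  define g where "g = weak_deriv T f"
  have g: "has_weak_deriv T f g"
    unfolding g_def by (rule has_weak_deriv_weak_deriv[OF assms(1)])
  note G = has_weak_deriv_eq_integral[OF g]
  have "norm (\<integral>s. indicator {0..t} s *\<^sub>R (indicator {0..T} s *\<^sub>R g s) \<partial>lebesgue)
      \<le> (\<integral>s. norm (indicator {0..T} s *\<^sub>R g s) \<partial>lebesgue)"
  proof (rule Bochner_Integration.integral_norm_bound_integral)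
    show "integrable lebesgue (\<lambda>s. indicator {0..t} s *\<^sub>R (indicator {0..T} s *\<^sub>R g s))"
      by (rule integrable_mult_indicator) (auto intro: G(1))
    show "integrable lebesgue (\<lambda>s. norm (indicator {0..T} s *\<^sub>R g s))"
      by (rule integrable_norm[OF G(1)])
  qed (auto simp: indicator_def)
  also have "\<dots> = (\<integral>s. indicator {0..T} s *\<^sub>R norm (g s) \<partial>lebesgue)"
    by (intro Bochner_Integration.integral_cong) auto
  also have "\<dots> = integral\<^sup>L (lebesgue_on {0..T}) (\<lambda>t. norm (g t))"
    by (rule integral_restrict_space[symmetric]) auto
  finally show ?thesis
    using G(2)[OF assms(2)] norm_triangle_ineq[of "f 0"] unfolding g_def
    by (metis add_left_mono order_trans)
qed

lemma W11_continuous_on: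
  assumes "f \<in> W11 T"
  shows "continuous_on {0..T} f"
proof (rule continuous_on_sequentiallyI)
  fix u t assume u: "\<forall>n. u n \<in> {0..T}" and t: "t \<in> {0..T}" and lim: "u \<longlonglongrightarrow> t"
  obtain g where g: "has_weak_deriv T f g" using assms unfolding W11_def by auto
  define G where "G = (\<lambda>s. indicator {0..T} s *\<^sub>R g s)"
  have G: "integrable lebesgue G" unfolding G_def by (rule has_weak_deriv_eq_integral[OF g])
  have fG: "f s = f 0 + (\<integral>r. indicator {0..s} r *\<^sub>R G r \<partial>lebesgue)" if "s \<in> {0..T}" for s
    unfolding G_def by (rule has_weak_deriv_eq_integral(2)[OF g that])
  have "(\<lambda>n. \<integral>r. indicator {0..u n} r *\<^sub>R G r \<partial>lebesgue) \<longlonglongrightarrow> (\<integral>r. indicator {0..t} r *\<^sub>R G r \<partial>lebesgue)"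
  proof (rule integral_dominated_convergence[where w = "\<lambda>r. norm (G r)"])
    \<comment> \<open>At \<open>r = t\<close> the indicators may oscillate; everywhere else they are
      eventually constant.\<close>
    have "AE r in lebesgue. r \<noteq> t"
      using AE_lborel_singleton[of t] by (rule AE_completion)
    then show "AE r in lebesgue. (\<lambda>n. indicator {0..u n} r *\<^sub>R G r) \<longlonglongrightarrow> indicator {0..t} r *\<^sub>R G r"
    proof (rule AE_mp, intro AE_I2 impI)
      fix r assume "r \<noteq> t"
      have "\<forall>\<^sub>F n in sequentially. (u n < r \<longleftrightarrow> t < r)"
      proof (cases "t < r")
        case True
        then show ?thesis using order_tendstoD(2)[OF lim True] by simp
      next
        case False
        then have "r < t" using \<open>r \<noteq> t\<close> by simp
        then show ?thesis using order_tendstoD(1)[OF lim \<open>r < t\<close>] by (auto elim!: eventually_mono)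
      qed
      then have "\<forall>\<^sub>F n in sequentially. indicator {0..u n} r *\<^sub>R G r = indicator {0..t} r *\<^sub>R G r"
        by (rule eventually_mono) (auto simp: indicator_def not_less[symmetric])
      then show "(\<lambda>n. indicator {0..u n} r *\<^sub>R G r) \<longlonglongrightarrow> indicator {0..t} r *\<^sub>R G r"
        by (rule tendsto_eventually)
    qed
  next
    have *: "(\<lambda>r. indicator {0..s} r *\<^sub>R G r) \<in> borel_measurable lebesgue" for s
      by (intro borel_measurable_scaleR borel_measurable_indicator borel_measurable_integrable[OF G]) simp
    show "(\<lambda>r. indicator {0..t} r *\<^sub>R G r) \<in> borel_measurable lebesgue"
      "(\<lambda>r. indicator {0..u n} r *\<^sub>R G r) \<in> borel_measurable lebesgue" for n
      by (rule *)+
  qed (use G in \<open>auto simp: indicator_def\<close>)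
  then show "(\<lambda>n. f (u n)) \<longlonglongrightarrow> f t"
    using u t by (subst fG[OF t], subst fG) (auto intro: tendsto_add)
qed

lemma W11_diff:
  assumes "f \<in> W11 T" "g \<in> W11 T"
  shows "(\<lambda>t. f t - g t) \<in> W11 T"
proof -
  obtain f' g' where fg: "has_weak_deriv T f f'" "has_weak_deriv T g g'"
    using assms unfolding W11_def by auto
  have "has_weak_deriv T (\<lambda>t. f t - g t) (\<lambda>t. f' t - g' t)"
    unfolding has_weak_deriv_def
  proof (intro conjI ballI)
    show "integrable (lebesgue_on {0..T}) (\<lambda>t. f' t - g' t)"
      using fg unfolding has_weak_deriv_def by auto
    fix t assume t: "t \<in> {0..T}"
    have "integrable (lebesgue_on {0..t}) f'" "integrable (lebesgue_on {0..t}) g'"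
      using fg t by (blast intro: has_weak_deriv_integrable)+
    then have "integral\<^sup>L (lebesgue_on {0..t}) (\<lambda>t. f' t - g' t)
        = integral\<^sup>L (lebesgue_on {0..t}) f' - integral\<^sup>L (lebesgue_on {0..t}) g'"
      by (rule Bochner_Integration.integral_diff)
    moreover have "f t = f 0 + integral\<^sup>L (lebesgue_on {0..t}) f'"
      "g t = g 0 + integral\<^sup>L (lebesgue_on {0..t}) g'"
      using fg t unfolding has_weak_deriv_def by blast+
    ultimately show "f t - g t = f 0 - g 0 + integral\<^sup>L (lebesgue_on {0..t}) (\<lambda>t. f' t - g' t)"
      by (simp only: add_diff_add)
  qed
  then show ?thesis unfolding W11_def by auto
qed

section \<open>The norms of control pairs as bounds for uniform closeness\<close>

lemma pair_diff_control_pairs: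
  assumes "p \<in> control_pairs T" "q \<in> control_pairs T"
  shows "pair_diff p q \<in> control_pairs T"
proof -
  obtain u b u' b' where "p = (u, b)" "q = (u', b')" by (cases p; cases q)
  then show ?thesis using assms by (simp add: control_pairs_def pair_diff_def W11_diff)
qed

lemma control_pairs_le_norm_11:
  fixes u :: "real \<Rightarrow> 'a::{real_inner, banach, second_countable_topology} ^ 'm::finite"
  assumes "(u, b) \<in> control_pairs T" "t \<in> {0..T}"
  shows "norm (u t $ i) \<le> norm_11 T (u, b)" "\<bar>b t $ i\<bar> \<le> norm_11 T (u, b)"
proof -
  define U where "U = (\<lambda>i. norm (u 0 $ i)
        + integral\<^sup>L (lebesgue_on {0..T}) (\<lambda>t. norm (weak_deriv T (\<lambda>s. u s $ i) t)))"
  define V where "V = (\<lambda>i. \<bar>b 0 $ i\<bar>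
        + integral\<^sup>L (lebesgue_on {0..T}) (\<lambda>t. \<bar>weak_deriv T (\<lambda>s. b s $ i) t\<bar>))"
  have "U i \<ge> 0" "V i \<ge> 0" for i
    by (simp_all add: U_def V_def)
  moreover from this have "U i \<le> sum U UNIV" "V i \<le> sum V UNIV" "sum U UNIV \<ge> 0" "sum V UNIV \<ge> 0"
    by (auto intro: member_le_sum sum_nonneg)
  moreover have "norm_11 T (u, b) = sum U UNIV + sum V UNIV"
    by (simp add: norm_11_def U_def V_def)
  moreover have "norm (u t $ i) \<le> U i" "\<bar>b t $ i\<bar> \<le> V i"
    using assms W11_norm_le[of "\<lambda>t. u t $ i" T t] W11_norm_le[of "\<lambda>t. b t $ i" T t]
    by (auto simp: control_pairs_def U_def V_def)
  ultimately show "norm (u t $ i) \<le> norm_11 T (u, b)" "\<bar>b t $ i\<bar> \<le> norm_11 T (u, b)"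
    by linarith+
qed

lemma control_pairs_le_norm_inf:
  fixes u :: "real \<Rightarrow> 'a::{real_inner, banach, second_countable_topology} ^ 'm::finite"
  assumes "(u, b) \<in> control_pairs T" "t \<in> {0..T}"
  shows "norm (u t $ i) \<le> norm_inf T (u, b)" "\<bar>b t $ i\<bar> \<le> norm_inf T (u, b)"
proof -
  \<comment> \<open>A real supremum bounds its family only if the family is bounded above;
    \<open>norm_11\<close> supplies such a bound.\<close>
  have bdd: "bdd_above ((\<lambda>(t, i). norm (u t $ i)) ` ({0..T} \<times> UNIV))"
    "bdd_above ((\<lambda>(t, i). \<bar>b t $ i\<bar>) ` ({0..T} \<times> UNIV))"
    using control_pairs_le_norm_11[OF assms(1)]
    by (auto intro!: bdd_aboveI2[where M = "norm_11 T (u, b)"])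
  have ti: "(t, i) \<in> {0..T} \<times> UNIV" using assms(2) by auto
  show "norm (u t $ i) \<le> norm_inf T (u, b)" "\<bar>b t $ i\<bar> \<le> norm_inf T (u, b)"
    using cSUP_upper[OF ti bdd(1)] cSUP_upper[OF ti bdd(2)] norm_ge_zero[of "u t $ i"] abs_ge_zero[of "b t $ i"]
    unfolding norm_inf_def by (simp_all del: norm_ge_zero abs_ge_zero)
qed

lemma norm_inf_nonneg:
  fixes p :: "(real \<Rightarrow> 'a::{real_inner, banach, second_countable_topology} ^ 'm::finite) \<times> (real \<Rightarrow> real ^ 'm)"
  assumes "p \<in> control_pairs T" "0 \<le> T"
  shows "0 \<le> norm_inf T p"
proof (cases p)
  case (Pair u b)
  have "0 \<in> {0..T}" using assms(2) by simp
  from order_trans[OF norm_ge_zero control_pairs_le_norm_inf(1)[OF assms(1)[unfolded Pair] this]]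
  show ?thesis unfolding Pair .
qed

lemma uniformly_close_norm_11:
  fixes u :: "real \<Rightarrow> 'a::{real_inner, banach, second_countable_topology} ^ 'm::finite"
  assumes "(u, b) \<in> control_pairs T" "(u', b') \<in> control_pairs T"
    "norm_11 T (pair_diff (u, b) (u', b')) \<le> e"
  shows "uniformly_close T e (u, b) (u', b')"
proof -
  have "(\<lambda>t. u t - u' t, \<lambda>t. b t - b' t) \<in> control_pairs T"
    using pair_diff_control_pairs[OF assms(1,2)] by (simp add: pair_diff_def)
  note N = control_pairs_le_norm_11[OF this]
  have "norm (u t $ i - u' t $ i) \<le> e \<and> \<bar>b t $ i - b' t $ i\<bar> \<le> e" if "t \<in> {0..T}" for t i
    using N[OF that, of i] assms(3) by (simp add: pair_diff_def)
  then show ?thesis by (simp add: uniformly_close_def)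
qed

lemma uniformly_close_norm_inf:
  fixes u :: "real \<Rightarrow> 'a::{real_inner, banach, second_countable_topology} ^ 'm::finite"
  assumes "(u, b) \<in> control_pairs T" "(u', b') \<in> control_pairs T"
  shows "uniformly_close T (norm_inf T (pair_diff (u, b) (u', b'))) (u, b) (u', b')"
proof -
  have "(\<lambda>t. u t - u' t, \<lambda>t. b t - b' t) \<in> control_pairs T"
    using pair_diff_control_pairs[OF assms] by (simp add: pair_diff_def)
  note N = control_pairs_le_norm_inf[OF this]
  show ?thesis
    using N by (simp add: uniformly_close_def pair_diff_def)
qed

section \<open>Chaining the local estimates\<close>

text \<open>The constants are fixed before the controls and solutions, and the bound depends on the
  states at \<open>c\<close>. The growth bound \<open>M\<close> is part of the statement so that the
  states at the start of the next interval are controlled.\<close>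

definition sweeping_estimate ::
    "real \<Rightarrow> (real \<Rightarrow> 'a::real_inner ^ 'm) \<times> (real \<Rightarrow> real ^ 'm)
       \<Rightarrow> real \<Rightarrow> real \<Rightarrow> real \<Rightarrow> real \<Rightarrow> real \<Rightarrow> bool" where
  "sweeping_estimate T q \<rho> M A c d \<longleftrightarrow> (\<forall>p p' x0 x0' x x' e.
     uniformly_close T \<rho> p q \<longrightarrow> uniformly_close T \<rho> p' q \<longrightarrow> uniformly_close T e p p' \<longrightarrow> 0 \<le> e \<longrightarrow>
     sweeping_solution T p x0 x \<longrightarrow> sweeping_solution T p' x0' x' \<longrightarrow>
     (\<forall>t\<in>{c..d}. norm (x t) \<le> norm (x c) + M \<and> norm (x' t) \<le> norm (x' c) + M \<and>
       (norm (x t - x' t))\<^sup>2 \<le> (norm (x c - x' c))\<^sup>2 + A * (1 + norm (x c) + norm (x' c)) ^ 4 * e))"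

lemma sweeping_estimateD:
  assumes "sweeping_estimate T q \<rho> M A c d"
    "uniformly_close T \<rho> p q" "uniformly_close T \<rho> p' q" "uniformly_close T e p p'" "0 \<le> e"
    "sweeping_solution T p x0 x" "sweeping_solution T p' x0' x'" "t \<in> {c..d}"
  shows "norm (x t) \<le> norm (x c) + M" "norm (x' t) \<le> norm (x' c) + M"
    "(norm (x t - x' t))\<^sup>2 \<le> (norm (x c - x' c))\<^sup>2 + A * (1 + norm (x c) + norm (x' c)) ^ 4 * e"
  using assms(1)[unfolded sweeping_estimate_def, rule_format, OF assms(2-8)] by blast+

lemma uniformly_close_mono:
  assumes "uniformly_close T e p q" "e \<le> e'"
  shows "uniformly_close T e' p q"
proof -
  have "norm (fst p t $ i - fst q t $ i) \<le> e'" "\<bar>snd p t $ i - snd q t $ i\<bar> \<le> e'" if "t \<in> {0..T}" for t i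
  proof -
    have "norm (fst p t $ i - fst q t $ i) \<le> e" "\<bar>snd p t $ i - snd q t $ i\<bar> \<le> e"
      using assms(1) that by (simp_all add: uniformly_close_def case_prod_unfold)
    then show "norm (fst p t $ i - fst q t $ i) \<le> e'" "\<bar>snd p t $ i - snd q t $ i\<bar> \<le> e'"
      using assms(2) by linarith+
  qed
  then show ?thesis by (simp add: uniformly_close_def case_prod_unfold)
qed

text \<open>The squared distance at the start enters with coefficient 1, so the errors of the two
  intervals simply add, once the states at \<open>b\<close> are expressed by those at
  \<open>a\<close>.\<close>

lemma sweeping_estimate_trans:
  assumes 1: "sweeping_estimate T q \<rho>1 M1 A1 a b" and 2: "sweeping_estimate T q \<rho>2 M2 A2 b c"
    and "a \<le> b" and nonneg: "M1 \<ge> 0" "M2 \<ge> 0" "A1 \<ge> 0" "A2 \<ge> 0"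
  shows "sweeping_estimate T q (min \<rho>1 \<rho>2) (M1 + M2) (A1 + A2 * (1 + 2 * M1) ^ 4) a c"
proof -
  define A where "A = A1 + A2 * (1 + 2 * M1) ^ 4"
  have "A1 \<le> A" using nonneg by (auto simp: A_def)
  have "norm (x t) \<le> norm (x a) + (M1 + M2) \<and> norm (x' t) \<le> norm (x' a) + (M1 + M2) \<and>
      (norm (x t - x' t))\<^sup>2 \<le> (norm (x a - x' a))\<^sup>2 + A * (1 + norm (x a) + norm (x' a)) ^ 4 * e"
    if p: "uniformly_close T (min \<rho>1 \<rho>2) p q" "uniformly_close T (min \<rho>1 \<rho>2) p' q"
      "uniformly_close T e p p'" "0 \<le> e"
      "sweeping_solution T p x0 x" "sweeping_solution T p' x0' x'" and t: "t \<in> {a..c}"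
    for p p' x0 x0' x x' e t
  proof -
    have u: "uniformly_close T \<rho>1 p q" "uniformly_close T \<rho>1 p' q"
      "uniformly_close T \<rho>2 p q" "uniformly_close T \<rho>2 p' q"
      using p(1,2) by (auto intro: uniformly_close_mono)
    note E1 = sweeping_estimateD[OF 1 u(1,2) p(3-6)] and E2 = sweeping_estimateD[OF 2 u(3,4) p(3-6)]
    define S where "S = 1 + norm (x a) + norm (x' a)"
    have "S \<ge> 1" by (simp add: S_def)
    have A1: "A1 * S ^ 4 * e \<le> A * S ^ 4 * e"
      using \<open>A1 \<le> A\<close> p(4) \<open>S \<ge> 1\<close> by (intro mult_right_mono) auto
    show ?thesis
    proof (cases "t \<le> b")
      case True
      then have "t \<in> {a..b}" using t by auto
      from E1[OF this] show ?thesis using A1 nonneg unfolding S_def by linarith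
    next
      case False
      then have "t \<in> {b..c}" "b \<in> {a..b}" using t \<open>a \<le> b\<close> by auto
      note E = E1[OF this(2)] E2[OF this(1)]
      have "2 * M1 * 1 \<le> 2 * M1 * S"
        \<comment> \<open>As \<open>S\<close> is at least 1, the additive growth
          \<open>2 * M1\<close> becomes the factor \<open>1 + 2 * M1\<close>, whose fourth power
          appears in \<open>A\<close>.\<close>
        using nonneg \<open>S \<ge> 1\<close> by (intro mult_left_mono) auto
      then have "1 + norm (x b) + norm (x' b) \<le> (1 + 2 * M1) * S"
        using E unfolding S_def by (simp add: algebra_simps)
      then have "(1 + norm (x b) + norm (x' b)) ^ 4 \<le> (1 + 2 * M1) ^ 4 * S ^ 4"
        unfolding power_mult_distrib[symmetric] by (intro power_mono) auto
      then have "A2 * (1 + norm (x b) + norm (x' b)) ^ 4 * e \<le> A2 * ((1 + 2 * M1) ^ 4 * S ^ 4) * e"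
        using nonneg p(4) by (intro mult_right_mono mult_left_mono) auto
      moreover have "A * S ^ 4 * e = A1 * S ^ 4 * e + A2 * ((1 + 2 * M1) ^ 4 * S ^ 4) * e"
        unfolding A_def by (simp only: distrib_right mult.assoc)
      ultimately show ?thesis using E unfolding S_def by linarith
    qed
  qed
  then show ?thesis
    unfolding sweeping_estimate_def A_def by blast
qed

section \<open>Local estimates from the Slater condition\<close>

lemma uniform_slater_local:
  fixes u :: "real \<Rightarrow> 'a::{real_inner, banach, second_countable_topology} ^ 'm::finite"
  assumes "(u, b) \<in> control_pairs T" "uniform_slater T (u, b)" "s \<in> {0..T}"
  obtains z \<eta> d where "\<eta> > 0" "d > 0"
    "\<And>t i. t \<in> {0..T} \<Longrightarrow> \<bar>t - s\<bar> < d \<Longrightarrow> u t $ i \<bullet> z + \<eta> \<le> b t $ i"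
proof -
  obtain z where z: "\<And>i. u s $ i \<bullet> z < b s $ i"
    using assms(2,3) unfolding uniform_slater_def by fastforce
  \<comment> \<open>Half of the smallest slack over the finitely many constraints at
    \<open>s\<close>; the other half leaves room for continuity in \<open>t\<close>.\<close>
  define \<eta> where "\<eta> = Min (range (\<lambda>i. b s $ i - u s $ i \<bullet> z)) / 2"
  have "\<eta> > 0" unfolding \<eta>_def using z by simp
  have \<eta>: "\<eta> < b s $ i - u s $ i \<bullet> z" for i
  proof -
    have "2 * \<eta> \<le> b s $ i - u s $ i \<bullet> z" unfolding \<eta>_def by (simp add: Min_le)
    then show ?thesis using \<open>\<eta> > 0\<close> by simp
  qed
  have "\<forall>\<^sub>F t in at s within {0..T}. \<forall>i. \<eta> < b t $ i - u t $ i \<bullet> z"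
  proof (rule eventually_all_finite)
    fix i
    have "continuous_on {0..T} (\<lambda>t. b t $ i - u t $ i \<bullet> z)"
      using assms(1) unfolding control_pairs_def
      by (intro continuous_on_diff continuous_on_inner continuous_on_const W11_continuous_on) auto
    then have "((\<lambda>t. b t $ i - u t $ i \<bullet> z) \<longlongrightarrow> b s $ i - u s $ i \<bullet> z) (at s within {0..T})"
      using assms(3) unfolding continuous_on_def by blast
    then show "\<forall>\<^sub>F t in at s within {0..T}. \<eta> < b t $ i - u t $ i \<bullet> z"
      using \<eta> by (rule order_tendstoD)
  qed
  then obtain d where d: "d > 0" "\<And>t i. t \<in> {0..T} \<Longrightarrow> t \<noteq> s \<Longrightarrow> \<bar>t - s\<bar> < d \<Longrightarrow> \<eta> < b t $ i - u t $ i \<bullet> z"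
    unfolding eventually_at dist_real_def by blast
  show thesis
  proof (rule that[OF \<open>\<eta> > 0\<close> d(1)])
    fix t i assume "t \<in> {0..T}" "\<bar>t - s\<bar> < d"
    \<comment> \<open>The punctured limit says nothing at \<open>t = s\<close>, where the choice of
      \<open>\<eta>\<close> is used directly.\<close>
    then show "u t $ i \<bullet> z + \<eta> \<le> b t $ i"
      using d(2)[of t i] \<eta>[of i] by (cases "t = s") auto
  qed
qed

lemma sweeping_estimate_local:
  fixes u0 :: "real \<Rightarrow> 'a::{real_inner, banach, second_countable_topology} ^ 'm::finite"
  assumes q: "(u0, b0) \<in> control_pairs T" "uniform_slater T (u0, b0)" and s: "s \<in> {0..T}"
  obtains \<delta> where "\<delta> > 0" "\<And>c d. c \<le> s \<Longrightarrow> s \<le> d \<Longrightarrow> d - c < \<delta> \<Longrightarrow> {c..d} \<subseteq> {0..T} \<Longrightarrow>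
    \<exists>\<rho>>0. \<exists>M\<ge>0. \<exists>A\<ge>0. sweeping_estimate T (u0, b0) \<rho> M A c d"
proof -
  obtain z \<eta> \<delta> where "\<eta> > 0" "\<delta> > 0" and
    z: "\<And>t i. t \<in> {0..T} \<Longrightarrow> \<bar>t - s\<bar> < \<delta> \<Longrightarrow> u0 t $ i \<bullet> z + \<eta> \<le> b0 t $ i"
    using uniform_slater_local[OF q s] by metis
  \<comment> \<open>A change of size \<open>\<rho>\<close> in the normals and right-hand sides costs
    at most \<open>\<rho> * norm z + \<rho> = \<eta> / 2\<close> of slack at \<open>z\<close>, so
    half of it survives for all controls this close.\<close>
  define \<rho> where "\<rho> = \<eta> / 2 / (1 + norm z)"
  define B where "B = norm_inf T (u0, b0) + \<rho>"
  have np: "1 + norm z > 0" by (simp add: add_pos_nonneg)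
  have "\<rho> * (1 + norm z) = \<eta> / 2"
    using np by (subst nonzero_eq_divide_eq[symmetric]) (auto simp: \<rho>_def)
  moreover have "\<rho> > 0" using np \<open>\<eta> > 0\<close> by (simp add: \<rho>_def)
  ultimately have \<rho>: "\<rho> > 0" "\<rho> * norm z + \<rho> = \<eta> / 2"
    by (simp_all add: algebra_simps)
  have "norm_inf T (u0, b0) \<ge> 0"
    using q(1) s by (intro norm_inf_nonneg) auto
  then have "B > 0" using \<rho>(1) by (simp add: B_def)
  have near: "w t $ i \<bullet> z + \<eta> / 2 \<le> g t $ i" "norm (w t $ i) \<le> B"
    if "uniformly_close T \<rho> (w, g) (u0, b0)" "t \<in> {0..T}" "\<bar>t - s\<bar> < \<delta>"
    for w :: "real \<Rightarrow> 'a ^ 'm" and g t i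
  proof -
    have c: "norm (w t $ i - u0 t $ i) \<le> \<rho>" "\<bar>g t $ i - b0 t $ i\<bar> \<le> \<rho>"
      using that by (auto simp: uniformly_close_def)
    have "(w t $ i - u0 t $ i) \<bullet> z \<le> norm (w t $ i - u0 t $ i) * norm z" by (rule norm_cauchy_schwarz)
    also have "\<dots> \<le> \<rho> * norm z" using c by (intro mult_right_mono) auto
    finally show "w t $ i \<bullet> z + \<eta> / 2 \<le> g t $ i"
      using z[OF that(2,3), of i] c(2) \<rho>(2) by (simp add: inner_diff_left)
    show "norm (w t $ i) \<le> B"
      using norm_triangle_sub[of "w t $ i" "u0 t $ i"] c(1) control_pairs_le_norm_inf(1)[OF q(1) that(2), of i]
      unfolding B_def by linarith
  qed
  define A where "A = 2 * B * (1 + 2 * norm z) ^ 4 / (\<eta> / 2)\<^sup>2"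
  have "A \<ge> 0" using \<open>B > 0\<close> by (simp add: A_def)
  show thesis
  proof (rule that[OF \<open>\<delta> > 0\<close>])
    fix c d assume cd: "c \<le> s" "s \<le> d" "d - c < \<delta>" "{c..d} \<subseteq> {0..T}"
    have I: "t \<in> {0..T} \<and> \<bar>t - s\<bar> < \<delta>" if "t \<in> {c..d}" for t
      using that cd by auto
    have "norm (x t) \<le> norm (x c) + 2 * norm z \<and> norm (x' t) \<le> norm (x' c) + 2 * norm z \<and>
        (norm (x t - x' t))\<^sup>2 \<le> (norm (x c - x' c))\<^sup>2 + A * (1 + norm (x c) + norm (x' c)) ^ 4 * e"
      if "uniformly_close T \<rho> p (u0, b0)" "uniformly_close T \<rho> p' (u0, b0)" "uniformly_close T e p p'" "0 \<le> e"
      "sweeping_solution T p x0 x" "sweeping_solution T p' x0' x'" "t \<in> {c..d}"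
      for p p' x0 x0' x x' e t
    proof -
      obtain u b u' b' where p: "p = (u, b)" "p' = (u', b')" by (cases p; cases p')
      have h: "0 < \<eta> / 2" using \<open>\<eta> > 0\<close> by simp
      note near1 = near[OF that(1)[unfolded p]] and near2 = near[OF that(2)[unfolded p]]
      show ?thesis
        unfolding A_def
        by (intro conjI sweeping_solutions_local_estimate[of T u b x0 x u' b' x0' x' c d t z "\<eta> / 2" B e])
          (use that[unfolded p] cd(4) I near1 near2 h \<open>B > 0\<close> in auto)
    qed
    then have "sweeping_estimate T (u0, b0) \<rho> (2 * norm z) A c d"
      unfolding sweeping_estimate_def by blast
    then show "\<exists>\<rho>>0. \<exists>M\<ge>0. \<exists>A\<ge>0. sweeping_estimate T (u0, b0) \<rho> M A c d"
      using \<rho>(1) \<open>A \<ge> 0\<close> by (intro exI[of _ \<rho>] exI[of _ "2 * norm z"] exI[of _ A] conjI) auto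
  qed
qed

theorem theorem4:
  fixes T :: real
    and ubar :: "real \<Rightarrow> 'a::{real_inner, banach, second_countable_topology} ^ 'm::finite"
    and bbar :: "real \<Rightarrow> real ^ 'm"
  assumes "T > 0"
    and "(ubar, bbar) \<in> control_pairs T"
    and "uniform_slater T (ubar, bbar)"
  shows "\<exists>\<rho>>0. \<exists>K :: 'a \<times> 'a \<Rightarrow> real. continuous_on UNIV K \<and> (\<forall>z. K z \<ge> 0) \<and>
    (\<forall>u b u' b' x0 x0' x x'.
       (u, b) \<in> ball_11 T (ubar, bbar) \<rho> \<longrightarrow>
       (u', b') \<in> ball_11 T (ubar, bbar) \<rho> \<longrightarrow>
       x0 \<in> moving_polyhedron (u, b) 0 \<longrightarrow>
       x0' \<in> moving_polyhedron (u', b') 0 \<longrightarrow>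
       sweeping_solution T (u, b) x0 x \<longrightarrow>
       sweeping_solution T (u', b') x0' x' \<longrightarrow>
       (\<forall>t\<in>{0..T}. (norm (x t - x' t))\<^sup>2 \<le>
          (norm (x0 - x0'))\<^sup>2
            + K (x0, x0') * norm_inf T (pair_diff (u, b) (u', b'))))"
proof -
  let ?stable = "\<lambda>c d. {c..d} \<subseteq> {0..T} \<longrightarrow>
    (\<exists>\<rho>>0. \<exists>M\<ge>0. \<exists>A\<ge>0. sweeping_estimate T (ubar, bbar) \<rho> M A c d)"
  \<comment> \<open>Compactness of \<open>[0,T]\<close> in the form of interval induction: stability
    holds near each point and survives concatenation, and the minimum of two radii remains
    positive.\<close>
  have "?stable 0 T"
  proof (rule Bolzano[where P = ?stable and a = 0 and b = T])
    fix a b c assume ab: "?stable a b" and bc: "?stable b c" and le: "a \<le> b" "b \<le> c"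
    show "?stable a c"
    proof
      assume "{a..c} \<subseteq> {0..T}"
      then have "{a..b} \<subseteq> {0..T}" "{b..c} \<subseteq> {0..T}" using le by auto
      then obtain \<rho>1 M1 A1 \<rho>2 M2 A2 where
        1: "\<rho>1 > 0" "M1 \<ge> 0" "A1 \<ge> 0" "sweeping_estimate T (ubar, bbar) \<rho>1 M1 A1 a b" and
        2: "\<rho>2 > 0" "M2 \<ge> 0" "A2 \<ge> 0" "sweeping_estimate T (ubar, bbar) \<rho>2 M2 A2 b c"
        using ab bc by blast
      show "\<exists>\<rho>>0. \<exists>M\<ge>0. \<exists>A\<ge>0. sweeping_estimate T (ubar, bbar) \<rho> M A a c"
        using sweeping_estimate_trans[OF 1(4) 2(4) le(1) 1(2) 2(2) 1(3) 2(3)] 1(1-3) 2(1-3)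
        by (intro exI[of _ "min \<rho>1 \<rho>2"] exI[of _ "M1 + M2"] exI[of _ "A1 + A2 * (1 + 2 * M1) ^ 4"] conjI)
          auto
    qed
  next
    fix s assume "0 \<le> s" "s \<le> T"
    then have "s \<in> {0..T}" by simp
    from sweeping_estimate_local[OF assms(2,3) this] obtain \<delta> where "\<delta> > 0"
      "\<And>c d. c \<le> s \<Longrightarrow> s \<le> d \<Longrightarrow> d - c < \<delta> \<Longrightarrow> ?stable c d"
      by metis
    then show "\<exists>\<delta>>0. \<forall>c d. c \<le> s \<and> s \<le> d \<and> d - c < \<delta> \<longrightarrow> ?stable c d" by blast
  qed (use assms(1) in simp)
  then obtain \<rho> M A where \<rho>: "\<rho> > 0" and A: "A \<ge> 0"
    and est: "sweeping_estimate T (ubar, bbar) \<rho> M A 0 T"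
    by blast
  \<comment> \<open>The factor of \<open>e\<close> in the estimate started at time 0, where the
    states are the initial values; as a polynomial in their norms it is continuous.\<close>
  define K where "K = (\<lambda>z :: 'a \<times> 'a. A * (1 + norm (fst z) + norm (snd z)) ^ 4)"
  have "continuous_on UNIV K" unfolding K_def by (intro continuous_intros)
  moreover have "K z \<ge> 0" for z using A by (simp add: K_def)
  moreover have "(norm (x t - x' t))\<^sup>2 \<le> (norm (x0 - x0'))\<^sup>2
        + K (x0, x0') * norm_inf T (pair_diff (u, b) (u', b'))"
    if p: "(u, b) \<in> ball_11 T (ubar, bbar) \<rho>" "(u', b') \<in> ball_11 T (ubar, bbar) \<rho>"
      and x: "sweeping_solution T (u, b) x0 x" "sweeping_solution T (u', b') x0' x'" and t: "t \<in> {0..T}"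
    for u b u' b' x0 x0' x x' t
  proof -
    have cp: "(u, b) \<in> control_pairs T" "(u', b') \<in> control_pairs T"
      using p by (auto simp: ball_11_def)
    \<comment> \<open>The ball in \<open>norm_11\<close> serves to place both controls uniformly
      within \<open>\<rho>\<close> of the reference; their mutual distance is then measured by
      \<open>norm_inf\<close>.\<close>
    have "uniformly_close T \<rho> (u, b) (ubar, bbar)" "uniformly_close T \<rho> (u', b') (ubar, bbar)"
      using p cp assms(2) by (auto simp: ball_11_def intro!: uniformly_close_norm_11)
    moreover note uc = uniformly_close_norm_inf[OF cp]
    moreover have "0 \<le> norm_inf T (pair_diff (u, b) (u', b'))"
      using assms(1) by (intro norm_inf_nonneg[OF pair_diff_control_pairs[OF cp]]) simp
    moreover have "x 0 = x0" "x' 0 = x0'" using x by (auto simp: sweeping_solution_def)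
    ultimately show ?thesis using sweeping_estimateD(3)[OF est _ _ _ _ x t] by (auto simp: K_def)
  qed
  ultimately show ?thesis using \<rho> by blast
qed

end
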